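(* For each $\varepsilon>0$ let $u^\varepsilon$ be the solution of the nonlocal Dirichlet problem $$u^\varepsilon_t(x,t)=\int_{\mathbb{R}^N\setminus A^\varepsilon}J(x-y)\,u^\varepsilon(y,t)\,dy-h_\varepsilon(x)\,u^\varepsilon(x,t)+g\big(m_{\Omega^\varepsilon}(x,u^\varepsilon(\cdot,t))\big),\qquad x\in\Omega^\varepsilon,\ t\in\mathbb{R},$$ $$u^\varepsilon(x,t)=0\ \text{ for } x\in\mathbb{R}^N\setminus\Omega^\varepsilon,\ t\in\mathbb{R},\qquad u^\varepsilon(x,0)=u_0(x)\ \text{ for } x\in\Omega^\varepsilon,\qquad h_\varepsilon\equiv 1 \text{ in } \mathbb{R}^N,$$ where $u_0\in L^2(\Omega)$. Then there exists a function $u^*=u^*(x,t)$, $x\in\mathbb{R}^N$, $t\in\mathbb{R}$, with $u^*(x,t)\equiv 0$ for $x\in\mathbb{R}^N\setminus\Omega$ and $u^*\in C^1([a,b];L^2(\mathbb{R}^N))$ for every closed bounded interval $[a,b]\subset\mathbb{R}$, such that, as $\varepsilon\to0$, $$u^\varepsilon\rightharpoonup u^*\quad\text{weakly}^*\text{ in }L^\infty([a,b];L^2(\Omega))$$ for every such $[a,b]$. Furthermore, $u^*$ satisfies the following nonlocal equation in $\Omega$ (that is, $u=u^*$ satisfies it): $$u_t(x,t)=\mathcal{X}(x)\int_{\mathbb{R}^N}J(x-y)\big(u(y,t)-u(x,t)\big)\,dy+\mathcal{X}(x)\,g\big(m_{\mathcal{X}}(x,u(\cdot,t))\big)+(\mathcal{X}(x)-1)\,u(x,t),$$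 with $u(x,t)\equiv0$ for $x\in\mathbb{R}^N\setminus\Omega$ and $u(x,0)=\mathcal{X}(x)\,u_0(x)$.
   Context: $\Omega\subset\mathbb{R}^N$ is a fixed bounded open domain, and for each $\varepsilon>0$, $\Omega^\varepsilon\subset\Omega$ is an open set; $A^\varepsilon=\Omega\setminus\Omega^\varepsilon$ (the holes). $\chi_\varepsilon$ is the characteristic function of $\Omega^\varepsilon$. It is assumed that there is $\mathcal{X}\in L^\infty(\mathbb{R}^N)$ with $\mathcal{X}\equiv0$ in $\mathbb{R}^N\setminus\Omega$ such that $\int_\Omega\chi_\varepsilon\varphi\,dx\to\int_\Omega\mathcal{X}\varphi\,dx$ as $\varepsilon\to0$ for all $\varphi\in L^1(\Omega)$, and that there is a constant $c>0$ with $\mathcal{X}(x)\ge c$ for all $x\in\Omega$ (consequently $\mathcal{X}\le1$). The kernel $J\in C(\mathbb{R}^N,\mathbb{R})$ is non-negative with $J(0)>0$, $J(-x)=J(x)$ for every $x$, and $\int_{\mathbb{R}^N}J(x)\,dx=1$. The function $g:\mathbb{R}\to\mathbb{R}$ is smooth and globally Lipschitz. $\delta>0$ is fixed and $B_\delta(x)$ is the ball of radius $\delta$ centered at $x$. The averages are $$m_{\Omega^\varepsilon}(x,u)=\frac{1}{|B_\delta(x)\cap\Omega^\varepsilon|}\int_{B_\delta(x)\cap\Omega^\varepsilon}u(y)\,dy,\quad x\in\Omega^\varepsilon,\qquad m_{\mathcal{X}}(x,u)=\frac{1}{\int_{B_\delta(x)}\mathcal{X}(y)\,dy}\int_{B_\delta(x)}u(y)\,dy,\quad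 x\in\Omega.$$ The solution $u^\varepsilon$ is the unique global one, with $u^\varepsilon\in C^1([a,b];L^2(\Omega^\varepsilon))$ for every bounded interval $[a,b]\subset\mathbb{R}$, the equation being understood in $L^2(\Omega^\varepsilon)$ for each $t$; likewise the limit equation is understood in $L^2(\Omega)$. *)

theory Defs
  imports "HOL-Analysis.Analysis"
begin

text \<open>
  Elements of \<open>L\<^sup>2(S)\<close> are represented by functions on the whole space, of which only the
  restriction to \<open>S\<close>, up to null sets, matters. An \<open>L\<^sup>2\<close>-valued map is a curried function
  \<open>u :: real \<Rightarrow> 'a \<Rightarrow> real\<close>, time first, so \<open>u t x\<close> is the value \<open>u(x,t)\<close>.
\<close>

definition L2_space :: "'a::euclidean_space set \<Rightarrow> ('a \<Rightarrow> real) set" where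
  "L2_space S = {f \<in> borel_measurable (lebesgue_on S). integrable (lebesgue_on S) (\<lambda>x. (f x)\<^sup>2)}"

definition norm_L2 :: "'a::euclidean_space set \<Rightarrow> ('a \<Rightarrow> real) \<Rightarrow> real" where
  "norm_L2 S f = sqrt (LINT x|lebesgue_on S. (f x)\<^sup>2)"

definition L2_continuous_on ::
  "real set \<Rightarrow> 'a::euclidean_space set \<Rightarrow> (real \<Rightarrow> 'a \<Rightarrow> real) \<Rightarrow> bool" where
  "L2_continuous_on I S u \<longleftrightarrow>
     (\<forall>t\<in>I. u t \<in> L2_space S) \<and>
     (\<forall>t\<in>I. ((\<lambda>s. norm_L2 S (\<lambda>x. u s x - u t x)) \<longlongrightarrow> 0) (at t within I))"

text \<open>
  \<open>u \<in> C\<^sup>1(I; L\<^sup>2(S))\<close> with derivative \<open>u'\<close>; difference quotients converge in the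
  \<open>L\<^sup>2(S)\<close> norm (one-sidedly at end points of \<open>I\<close>).
\<close>

definition L2_C1_deriv_on ::
  "real set \<Rightarrow> 'a::euclidean_space set \<Rightarrow> (real \<Rightarrow> 'a \<Rightarrow> real) \<Rightarrow> (real \<Rightarrow> 'a \<Rightarrow> real) \<Rightarrow> bool" where
  "L2_C1_deriv_on I S u u' \<longleftrightarrow>
     L2_continuous_on I S u \<and> L2_continuous_on I S u' \<and>
     (\<forall>t\<in>I. ((\<lambda>s. norm_L2 S (\<lambda>x. (u s x - u t x) / (s - t) - u' t x)) \<longlongrightarrow> 0) (at t within I))"

text \<open>
  The Bochner spaces \<open>L\<^sup>1([a,b]; L\<^sup>2(S))\<close> and \<open>L\<^sup>\<infinity>([a,b]; L\<^sup>2(S))\<close>, by strong measurability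
  (almost everywhere limit of simple \<open>L\<^sup>2(S)\<close>-valued functions).
\<close>

definition L2_strongly_measurable ::
  "real \<Rightarrow> real \<Rightarrow> 'a::euclidean_space set \<Rightarrow> (real \<Rightarrow> 'a \<Rightarrow> real) \<Rightarrow> bool" where
  "L2_strongly_measurable a b S u \<longleftrightarrow>
     (\<forall>t\<in>{a..b}. u t \<in> L2_space S) \<and>
     (\<exists>s :: nat \<Rightarrow> real \<Rightarrow> 'a \<Rightarrow> real.
        (\<forall>n. simple_function (lebesgue_on {a..b}) (s n) \<and> (\<forall>t\<in>{a..b}. s n t \<in> L2_space S)) \<and>
        (AE t in lebesgue_on {a..b}. (\<lambda>n. norm_L2 S (\<lambda>x. s n t x - u t x)) \<longlonglongrightarrow> 0))"

definition L1_L2 ::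
  "real \<Rightarrow> real \<Rightarrow> 'a::euclidean_space set \<Rightarrow> (real \<Rightarrow> 'a \<Rightarrow> real) set" where
  "L1_L2 a b S = {u. L2_strongly_measurable a b S u \<and>
                     integrable (lebesgue_on {a..b}) (\<lambda>t. norm_L2 S (u t))}"

definition Linf_L2 ::
  "real \<Rightarrow> real \<Rightarrow> 'a::euclidean_space set \<Rightarrow> (real \<Rightarrow> 'a \<Rightarrow> real) set" where
  "Linf_L2 a b S = {u. L2_strongly_measurable a b S u \<and>
                       (\<exists>M. AE t in lebesgue_on {a..b}. norm_L2 S (u t) \<le> M)}"

text \<open>
  Weak* convergence in \<open>L\<^sup>\<infinity>([a,b]; L\<^sup>2(S))\<close>, as the dual of \<open>L\<^sup>1([a,b]; L\<^sup>2(S))\<close>, along the filter \<open>F\<close>.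
\<close>

definition weakstar_Linf_L2 ::
  "real \<Rightarrow> real \<Rightarrow> 'a::euclidean_space set \<Rightarrow> ('e \<Rightarrow> real \<Rightarrow> 'a \<Rightarrow> real) \<Rightarrow> (real \<Rightarrow> 'a \<Rightarrow> real)
     \<Rightarrow> 'e filter \<Rightarrow> bool" where
  "weakstar_Linf_L2 a b S U u F \<longleftrightarrow>
     (\<forall>\<^sub>F e in F. U e \<in> Linf_L2 a b S) \<and> u \<in> Linf_L2 a b S \<and>
     (\<forall>\<phi>\<in>L1_L2 a b S.
        ((\<lambda>e. LINT t|lebesgue_on {a..b}. LINT x|lebesgue_on S. U e t x * \<phi> t x) \<longlongrightarrow>
         (LINT t|lebesgue_on {a..b}. LINT x|lebesgue_on S. u t x * \<phi> t x)) F)"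

definition smooth_real :: "(real \<Rightarrow> real) \<Rightarrow> bool" where
  "smooth_real g \<longleftrightarrow> (\<forall>k. (deriv ^^ k) g differentiable_on UNIV)"

definition mean_on :: "real \<Rightarrow> 'a::euclidean_space set \<Rightarrow> 'a \<Rightarrow> ('a \<Rightarrow> real) \<Rightarrow> real" where
  "mean_on \<delta> S x v =
     (LINT y:(ball x \<delta> \<inter> S)|lebesgue. v y) / measure lebesgue (ball x \<delta> \<inter> S)"

text \<open>The weight enters only the denominator.\<close>

definition mean_weight :: "real \<Rightarrow> ('a::euclidean_space \<Rightarrow> real) \<Rightarrow> 'a \<Rightarrow> ('a \<Rightarrow> real) \<Rightarrow> real" where
  "mean_weight \<delta> w x v = (LINT y:ball x \<delta>|lebesgue. v y) / (LINT y:ball x \<delta>|lebesgue. w y)"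

text \<open>
  \<open>u\<close> solves the nonlocal Dirichlet problem in the perforated set \<open>P \<subseteq> \<Omega>\<close> with holes \<open>\<Omega> - P\<close>;
  the equation is an identity in \<open>L\<^sup>2(P)\<close> for every \<open>t\<close>.
\<close>

definition perforated_solution ::
  "('a::euclidean_space \<Rightarrow> real) \<Rightarrow> (real \<Rightarrow> real) \<Rightarrow> real \<Rightarrow> ('a \<Rightarrow> real) \<Rightarrow> 'a set \<Rightarrow> 'a set
     \<Rightarrow> ('a \<Rightarrow> real) \<Rightarrow> (real \<Rightarrow> 'a \<Rightarrow> real) \<Rightarrow> bool" where
  "perforated_solution J g \<delta> h \<Omega> P u0 u \<longleftrightarrow>
     (\<forall>t. \<forall>x. x \<notin> P \<longrightarrow> u t x = 0) \<and>
     (AE x in lebesgue_on P. u 0 x = u0 x) \<and>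
     (\<exists>u'. (\<forall>a b. a < b \<longrightarrow> L2_C1_deriv_on {a..b} P u u') \<and>
           (\<forall>t. AE x in lebesgue_on P.
              u' t x = (LINT y:(UNIV - (\<Omega> - P))|lebesgue. J (x - y) * u t y)
                       - h x * u t x + g (mean_on \<delta> P x (u t))))"

definition limit_solution ::
  "('a::euclidean_space \<Rightarrow> real) \<Rightarrow> (real \<Rightarrow> real) \<Rightarrow> real \<Rightarrow> ('a \<Rightarrow> real) \<Rightarrow> 'a set
     \<Rightarrow> ('a \<Rightarrow> real) \<Rightarrow> (real \<Rightarrow> 'a \<Rightarrow> real) \<Rightarrow> bool" where
  "limit_solution J g \<delta> \<X> \<Omega> u0 u \<longleftrightarrow>
     (\<forall>t. \<forall>x. x \<notin> \<Omega> \<longrightarrow> u t x = 0) \<and>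
     (AE x in lebesgue_on \<Omega>. u 0 x = \<X> x * u0 x) \<and>
     (\<exists>u'. (\<forall>a b. a < b \<longrightarrow> L2_C1_deriv_on {a..b} UNIV u u') \<and>
           (\<forall>t. AE x in lebesgue_on \<Omega>.
              u' t x = \<X> x * (LINT y|lebesgue. J (x - y) * (u t y - u t x))
                       + \<X> x * g (mean_weight \<delta> \<X> x (u t)) + (\<X> x - 1) * u t x))"

end

theory Submission
  imports Defs
begin

text \<open>
  Write \<open>A\<^sub>1 w = \<integral> J (x - y) w y\<close> and \<open>A\<^sub>2 w = \<integral> 1\<^bsub>B(x,\<delta>)\<^esub> w\<close> for integrals over \<open>\<Omega>\<close>, and
  \<open>F\<^sub>\<rho> w = A\<^sub>1 w + g (A\<^sub>2 w / A\<^sub>2 \<rho>)\<close>. On the perforated set \<open>P\<close> with indicator \<open>1\<^sub>P\<close> the solution satisfies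
  \<open>u' = F (u) - u\<close> with weight \<open>1\<^sub>P\<close>, and the limit equation is \<open>u' = \<X> F (u) - u\<close> with weight \<open>\<X>\<close>,
  because \<open>J\<close> has integral 1. The decisive substitution is \<open>u\<^sup>* = \<X> z\<close>, where \<open>z\<close> solves
  \<open>z' = F (\<X> z) - z\<close> with weight \<open>\<X>\<close> and \<open>z 0 = u0\<close>: the weakly convergent factor is split off, and
  \<open>u\<^sup>\<epsilon>\<close> turns out to be close to \<open>1\<^sub>P z\<close> in the norm of \<open>L\<^sup>2\<close>, uniformly on bounded time intervals.
  No compactness of the solutions is needed, so the whole family converges at once.

  The operators \<open>A\<^sub>1\<close> and \<open>A\<^sub>2\<close> map integrable functions to bounded continuous ones. Hence
  \<open>z t = s t * u0 + p t\<close> with a number \<open>s t\<close> and a bounded continuous function \<open>p t\<close>, and \<open>(s, p)\<close> solves an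
  autonomous Lipschitz differential equation in a Banach space (\<open>global_Lipschitz_ode_solution\<close>,
  \<open>vector_field_Lipschitz\<close>).

  For the comparison, weak convergence of \<open>1\<^sub>P\<close> to \<open>\<X>\<close> is uniform over families of test functions that
  are compact in \<open>L\<^sup>1\<close> (\<open>uniform_limit_weak_convergence\<close>); this gives \<open>F (1\<^sub>P z) \<rightarrow> F (\<X> z)\<close> uniformly
  in \<open>(t, x)\<close> (\<open>uniform_limit_reaction\<close>). The energy \<open>E t = \<integral>\<^sub>P (u\<^sup>\<epsilon> t - z t)\<^sup>2\<close> vanishes at \<open>t = 0\<close> and
  satisfies \<open>\<bar>E'\<bar> \<le> C E + r\<^sup>2\<close> with \<open>r\<close> the uniform error, so it is small by Gronwall
  (\<open>energy_estimate\<close>). Finally \<open>\<integral> u\<^sup>\<epsilon> \<phi> = \<integral> (u\<^sup>\<epsilon> - 1\<^sub>P z) \<phi> + \<integral> 1\<^sub>P z \<phi>\<close> converges to \<open>\<integral> \<X> z \<phi>\<close> for each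
  time, and dominated convergence in time gives weak* convergence (\<open>weakstar_Linf_L2_pointwise\<close>).
\<close>

section \<open>Square-integrable functions\<close>

lemma L2_space_measurable: "f \<in> L2_space S \<Longrightarrow> f \<in> borel_measurable (lebesgue_on S)"
  and L2_space_square_integrable: "f \<in> L2_space S \<Longrightarrow> integrable (lebesgue_on S) (\<lambda>x. (f x)\<^sup>2)"
  by (auto simp: L2_space_def)

lemma norm_L2_nonneg [simp]: "norm_L2 S f \<ge> 0"
  by (simp add: norm_L2_def integral_nonneg_AE)

lemma norm_L2_squared: "(norm_L2 S f)\<^sup>2 = (LINT x|lebesgue_on S. (f x)\<^sup>2)"
  by (simp add: norm_L2_def integral_nonneg_AE)

lemma norm_L2_abs_le:
  assumes "f \<in> borel_measurable (lebesgue_on S)" "g \<in> L2_space S"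
    and "AE x in lebesgue_on S. \<bar>f x\<bar> \<le> \<bar>g x\<bar>"
  shows "f \<in> L2_space S" "norm_L2 S f \<le> norm_L2 S g"
proof -
  note [measurable] = assms(1)
  have g: "integrable (lebesgue_on S) (\<lambda>x. (g x)\<^sup>2)"
    using assms(2) by (rule L2_space_square_integrable)
  have le: "AE x in lebesgue_on S. (f x)\<^sup>2 \<le> (g x)\<^sup>2"
    using assms(3) by (simp add: abs_le_square_iff)
  have f: "integrable (lebesgue_on S) (\<lambda>x. (f x)\<^sup>2)"
    by (rule Bochner_Integration.integrable_bound[OF g]) (use le in auto)
  then show "f \<in> L2_space S" by (simp add: L2_space_def)
  show "norm_L2 S f \<le> norm_L2 S g"
    unfolding norm_L2_def by (intro real_sqrt_le_mono integral_mono_AE f g le)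
qed

lemma L2_mult_integrable:
  assumes "f \<in> L2_space S" "g \<in> L2_space S"
  shows "integrable (lebesgue_on S) (\<lambda>x. f x * g x)"
proof (rule Bochner_Integration.integrable_bound)
  note [measurable] = assms[THEN L2_space_measurable]
  show "integrable (lebesgue_on S) (\<lambda>x. (f x)\<^sup>2 + (g x)\<^sup>2)"
    using assms by (auto intro: L2_space_square_integrable)
  show "(\<lambda>x. f x * g x) \<in> borel_measurable (lebesgue_on S)" by measurable
  have "\<bar>a * b\<bar> \<le> a\<^sup>2 + b\<^sup>2" for a b :: real
  proof -
    have "2 * \<bar>a * b\<bar> \<le> a\<^sup>2 + b\<^sup>2"
      using sum_squares_bound[of "\<bar>a\<bar>" "\<bar>b\<bar>"] by (simp add: abs_mult)
    then show ?thesis by linarith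
  qed
  then show "AE x in lebesgue_on S. norm (f x * g x) \<le> norm ((f x)\<^sup>2 + (g x)\<^sup>2)"
    by auto
qed

lemma L2_Cauchy_Schwarz:
  assumes f: "f \<in> L2_space S" and g: "g \<in> L2_space S"
  shows "\<bar>LINT x|lebesgue_on S. f x * g x\<bar> \<le> norm_L2 S f * norm_L2 S g"
proof -
  note int = L2_mult_integrable[OF f g] L2_space_square_integrable[OF f] L2_space_square_integrable[OF g]
  define A B C where "A = (LINT x|lebesgue_on S. (f x)\<^sup>2)" and "B = (LINT x|lebesgue_on S. f x * g x)"
    and "C = (LINT x|lebesgue_on S. (g x)\<^sup>2)"
  have C0: "C \<ge> 0" and A0: "A \<ge> 0" by (auto simp: A_def C_def integral_nonneg_AE)
  have quad: "0 \<le> A + 2 * t * B + t\<^sup>2 * C" for t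
  proof -
    have "0 \<le> (LINT x|lebesgue_on S. (f x + t * g x)\<^sup>2)" by (intro integral_nonneg_AE) auto
    also have "\<dots> = (LINT x|lebesgue_on S. (f x)\<^sup>2 + 2 * t * (f x * g x) + t\<^sup>2 * (g x)\<^sup>2)"
      by (intro Bochner_Integration.integral_cong) (auto simp: power2_eq_square algebra_simps)
    also have "\<dots> = A + 2 * t * B + t\<^sup>2 * C"
      using int by (simp add: A_def B_def C_def)
    finally show ?thesis .
  qed
  have "B\<^sup>2 \<le> A * C"
  proof (cases "C = 0")
    case True
    have "B = 0"
    proof (rule ccontr)
      assume "B \<noteq> 0"
      then show False using quad[of "- (A + 1) / (2 * B)"] True by (simp add: field_simps)
    qed
    then show ?thesis using True by simp
  next
    case False
    then have C: "C > 0" using C0 by simp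
    have "0 \<le> A - B\<^sup>2 / C"
      using quad[of "- B / C"] C by (simp add: field_simps power2_eq_square)
    then show ?thesis using C by (simp add: field_simps)
  qed
  then have "sqrt (B\<^sup>2) \<le> sqrt (A * C)" by (rule real_sqrt_le_mono)
  then show ?thesis by (simp add: real_sqrt_mult norm_L2_def A_def B_def C_def)
qed

lemma L2_scale:
  assumes "f \<in> L2_space S"
  shows "(\<lambda>x. c * f x) \<in> L2_space S" "norm_L2 S (\<lambda>x. c * f x) = \<bar>c\<bar> * norm_L2 S f"
  using assms by (auto simp: L2_space_def norm_L2_def power_mult_distrib real_sqrt_mult)

lemma L2_add:
  assumes f: "f \<in> L2_space S" and g: "g \<in> L2_space S"
  shows "(\<lambda>x. f x + g x) \<in> L2_space S"
    and "norm_L2 S (\<lambda>x. f x + g x) \<le> norm_L2 S f + norm_L2 S g"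
proof -
  note int = L2_mult_integrable[OF f g] L2_space_square_integrable[OF f] L2_space_square_integrable[OF g]
  note [measurable] = f[THEN L2_space_measurable] g[THEN L2_space_measurable]
  have eq: "(f x + g x)\<^sup>2 = (f x)\<^sup>2 + 2 * (f x * g x) + (g x)\<^sup>2" for x
    by (simp add: power2_eq_square algebra_simps)
  show "(\<lambda>x. f x + g x) \<in> L2_space S"
    using int by (simp add: L2_space_def eq)
  have "(norm_L2 S (\<lambda>x. f x + g x))\<^sup>2 = (norm_L2 S f)\<^sup>2 + 2 * (LINT x|lebesgue_on S. f x * g x) + (norm_L2 S g)\<^sup>2"
    using int by (simp add: norm_L2_squared eq)
  also have "\<dots> \<le> (norm_L2 S f)\<^sup>2 + 2 * (norm_L2 S f * norm_L2 S g) + (norm_L2 S g)\<^sup>2"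
    using L2_Cauchy_Schwarz[OF f g] by simp
  also have "\<dots> = (norm_L2 S f + norm_L2 S g)\<^sup>2"
    by (simp add: power2_eq_square algebra_simps)
  finally show "norm_L2 S (\<lambda>x. f x + g x) \<le> norm_L2 S f + norm_L2 S g"
    by (rule power2_le_imp_le) simp
qed

lemma L2_diff:
  assumes f: "f \<in> L2_space S" and g: "g \<in> L2_space S"
  shows "(\<lambda>x. f x - g x) \<in> L2_space S"
    and "norm_L2 S (\<lambda>x. f x - g x) \<le> norm_L2 S f + norm_L2 S g"
  using L2_add[OF f L2_scale(1)[OF g, of "-1"]] L2_scale(2)[OF g, of "-1"] by auto

lemma norm_L2_diff_commute: "norm_L2 S (\<lambda>x. f x - g x) = norm_L2 S (\<lambda>x. g x - f x)"
  by (simp add: norm_L2_def power2_commute)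

lemma norm_L2_diff_bound:
  assumes "f \<in> L2_space S" "g \<in> L2_space S"
  shows "\<bar>norm_L2 S f - norm_L2 S g\<bar> \<le> norm_L2 S (\<lambda>x. f x - g x)"
  using L2_add(2)[OF L2_diff(1)[OF assms] assms(2)]
    L2_add(2)[OF L2_diff(1)[OF assms(2) assms(1)] assms(1)]
  by (simp add: norm_L2_diff_commute[of S g f])

lemma L2_bounded:
  assumes "finite_measure (lebesgue_on S)" "f \<in> borel_measurable (lebesgue_on S)"
    and "\<And>x. x \<in> S \<Longrightarrow> \<bar>f x\<bar> \<le> B"
  shows "f \<in> L2_space S"
proof -
  interpret finite_measure "lebesgue_on S" by fact
  have "integrable (lebesgue_on S) (\<lambda>x. (f x)\<^sup>2)"
  proof (rule integrable_const_bound)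
    show "AE x in lebesgue_on S. norm ((f x)\<^sup>2) \<le> B\<^sup>2"
      using assms(3) by (intro AE_I2) (force simp: abs_le_square_iff[symmetric])
  qed (use assms(2) in measurable)
  with assms(2) show ?thesis by (simp add: L2_space_def)
qed

lemma L2_imp_L1:
  assumes fin: "finite_measure (lebesgue_on S)" and f: "f \<in> L2_space S"
  shows "integrable (lebesgue_on S) f"
    and "(LINT x|lebesgue_on S. \<bar>f x\<bar>)\<^sup>2 \<le> measure (lebesgue_on S) (space (lebesgue_on S)) * (LINT x|lebesgue_on S. (f x)\<^sup>2)"
proof -
  interpret finite_measure "lebesgue_on S" by fact
  note [measurable] = f[THEN L2_space_measurable]
  have one: "(\<lambda>x. 1) \<in> L2_space S" using fin by (rule L2_bounded[where B=1]) auto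
  show "integrable (lebesgue_on S) f" using L2_mult_integrable[OF f one] by simp
  have af: "(\<lambda>x. \<bar>f x\<bar>) \<in> L2_space S" using f by (simp add: L2_space_def)
  have "\<bar>LINT x|lebesgue_on S. \<bar>f x\<bar>\<bar> \<le> norm_L2 S (\<lambda>x. \<bar>f x\<bar>) * norm_L2 S (\<lambda>x. 1)"
    using L2_Cauchy_Schwarz[OF af one] by simp
  then have "\<bar>LINT x|lebesgue_on S. \<bar>f x\<bar>\<bar>\<^sup>2 \<le> (norm_L2 S (\<lambda>x. \<bar>f x\<bar>) * norm_L2 S (\<lambda>x. 1))\<^sup>2"
    by (rule power_mono) simp
  then show "(LINT x|lebesgue_on S. \<bar>f x\<bar>)\<^sup>2 \<le> measure (lebesgue_on S) (space (lebesgue_on S)) * (LINT x|lebesgue_on S. (f x)\<^sup>2)"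
    by (simp add: power_mult_distrib norm_L2_squared mult.commute)
qed

text \<open>
  Functions vanishing on \<open>S - P\<close> have the same integrals, norms and continuity over \<open>S\<close> as over \<open>P\<close>;
  this moves statements between the perforated set, \<open>\<Omega>\<close> and the whole space.
\<close>

lemma integral_lebesgue_on_superset:
  fixes f :: "'a::euclidean_space \<Rightarrow> real"
  assumes "P \<in> sets lebesgue" "S \<in> sets lebesgue" "P \<subseteq> S" "\<And>x. x \<in> S - P \<Longrightarrow> f x = 0"
  shows "integrable (lebesgue_on S) f \<longleftrightarrow> integrable (lebesgue_on P) f"
    and "(LINT x|lebesgue_on S. f x) = (LINT x|lebesgue_on P. f x)"
    and "f \<in> borel_measurable (lebesgue_on S) \<longleftrightarrow> f \<in> borel_measurable (lebesgue_on P)"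
proof -
  have "(\<lambda>x. indicator S x *\<^sub>R f x) = (\<lambda>x. indicator P x *\<^sub>R f x)"
    using assms(3,4) by (auto simp: fun_eq_iff indicator_def)
  then show "integrable (lebesgue_on S) f \<longleftrightarrow> integrable (lebesgue_on P) f"
    and "(LINT x|lebesgue_on S. f x) = (LINT x|lebesgue_on P. f x)"
    and "f \<in> borel_measurable (lebesgue_on S) \<longleftrightarrow> f \<in> borel_measurable (lebesgue_on P)"
    using assms(1,2)
    by (simp_all add: integrable_restrict_space integral_restrict_space borel_measurable_restrict_space_iff)
qed

lemma L2_superset:
  assumes "P \<in> sets lebesgue" "S \<in> sets lebesgue" "P \<subseteq> S" "\<And>x. x \<in> S - P \<Longrightarrow> f x = 0"
  shows "f \<in> L2_space S \<longleftrightarrow> f \<in> L2_space P" and "norm_L2 S f = norm_L2 P f"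
proof -
  have sq: "\<And>x. x \<in> S - P \<Longrightarrow> (f x)\<^sup>2 = 0" using assms(4) by simp
  note * = integral_lebesgue_on_superset[OF assms(1-3)]
  show "f \<in> L2_space S \<longleftrightarrow> f \<in> L2_space P" "norm_L2 S f = norm_L2 P f"
    using *(1,2)[of "\<lambda>x. (f x)\<^sup>2"] *(3)[of f] sq assms(4) by (simp_all add: L2_space_def norm_L2_def)
qed

lemma L2_subset:
  assumes P: "P \<in> sets lebesgue" "S \<in> sets lebesgue" "P \<subseteq> S" and f: "f \<in> L2_space S"
  shows "f \<in> L2_space P" "norm_L2 P f \<le> norm_L2 S f"
proof -
  let ?f = "\<lambda>x. indicator P x * f x"
  have m: "?f \<in> borel_measurable (lebesgue_on S)"
    using L2_space_measurable[OF f] P(1)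
    by (intro borel_measurable_times borel_measurable_indicator) (auto simp: sets_restrict_space_iff P)
  have "AE x in lebesgue_on S. \<bar>?f x\<bar> \<le> \<bar>f x\<bar>" by (auto simp: indicator_def)
  note le = norm_L2_abs_le[OF m f this]
  have "norm_L2 P f = norm_L2 P ?f"
    unfolding norm_L2_def by (intro arg_cong[where f=sqrt] Bochner_Integration.integral_cong) auto
  moreover have "?f \<in> L2_space P \<longleftrightarrow> f \<in> L2_space P"
    unfolding L2_space_def mem_Collect_eq
    by (intro conj_cong measurable_cong Bochner_Integration.integrable_cong) auto
  ultimately show "f \<in> L2_space P" "norm_L2 P f \<le> norm_L2 S f"
    using le L2_superset[OF P, of ?f] by auto
qed

lemma L2_continuous_on_superset:
  assumes "P \<in> sets lebesgue" "S \<in> sets lebesgue" "P \<subseteq> S" "\<And>t x. x \<in> S - P \<Longrightarrow> u t x = 0"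
  shows "L2_continuous_on I S u \<longleftrightarrow> L2_continuous_on I P u"
proof -
  note sup = L2_superset[OF assms(1-3)]
  have "u t \<in> L2_space S \<longleftrightarrow> u t \<in> L2_space P"
    "norm_L2 S (\<lambda>x. u s x - u t x) = norm_L2 P (\<lambda>x. u s x - u t x)" for s t
    using assms(4) by (auto intro!: sup)
  then show ?thesis by (simp add: L2_continuous_on_def)
qed

text \<open>
  A bounded linear map \<open>V\<close> from a normed space to \<open>L\<^sup>2(S)\<close>, given by its pointwise values, carries
  \<open>C\<^sup>1\<close> curves to \<open>C\<^sup>1\<close> curves.
\<close>

lemma L2_C1_deriv_on_bounded_linear_image:
  fixes V :: "'b::real_normed_vector \<Rightarrow> 'a::euclidean_space \<Rightarrow> real"
  assumes diff: "\<And>v w y. V (v - w) y = V v y - V w y"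
    and scale: "\<And>k v y. V (k *\<^sub>R v) y = k * V v y"
    and L2: "\<And>v. V v \<in> L2_space S" and bd: "\<And>v. norm_L2 S (V v) \<le> C * norm v"
    and der: "\<And>t. (x has_vector_derivative x' t) (at t)"
    and cont: "continuous_on UNIV x'"
  shows "L2_C1_deriv_on I S (\<lambda>t. V (x t)) (\<lambda>t. V (x' t))"
proof -
  have V0: "((\<lambda>s. norm_L2 S (V (v s))) \<longlongrightarrow> 0) F" if "(v \<longlongrightarrow> 0) F" for v :: "real \<Rightarrow> 'b" and F
  proof (rule tendsto_sandwich[where f="\<lambda>_. 0" and h="\<lambda>s. C * norm (v s)"])
    show "((\<lambda>s. C * norm (v s)) \<longlongrightarrow> 0) F"
      using that by (intro tendsto_mult_right_zero tendsto_norm_zero)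
  qed (use bd in auto)
  have cV: "L2_continuous_on I S (\<lambda>t. V (y t))" if "continuous_on UNIV y" for y :: "real \<Rightarrow> 'b"
    unfolding L2_continuous_on_def
  proof safe
    fix t assume "t \<in> I"
    have "(y \<longlongrightarrow> y t) (at t within I)"
      using that continuous_on_eq_continuous_at[OF open_UNIV, of y]
      by (auto simp: isCont_def intro: tendsto_within_subset[where S=UNIV])
    then have "((\<lambda>s. y s - y t) \<longlongrightarrow> 0) (at t within I)" by (simp add: LIM_zero)
    from V0[OF this] show "((\<lambda>s. norm_L2 S (\<lambda>x. V (y s) x - V (y t) x)) \<longlongrightarrow> 0) (at t within I)"
      by (simp add: diff[symmetric])
  qed (rule L2)
  have "continuous_on UNIV x"
    using der by (meson continuous_at_imp_continuous_on has_vector_derivative_continuous)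
  moreover have "((\<lambda>s. norm_L2 S (\<lambda>y. (V (x s) y - V (x t) y) / (s - t) - V (x' t) y)) \<longlongrightarrow> 0) (at t within I)" for t
  proof -
    have "(x has_vector_derivative x' t) (at t within I)"
      using der by (rule has_vector_derivative_at_within)
    then have "((\<lambda>s. norm (x s - x t - (s - t) *\<^sub>R x' t) / norm (s - t)) \<longlongrightarrow> 0) (at t within I)"
      by (simp add: has_vector_derivative_def has_derivative_iff_norm)
    moreover have "norm (x s - x t - (s - t) *\<^sub>R x' t) / norm (s - t) = norm ((x s - x t) /\<^sub>R (s - t) - x' t)"
      if "s \<noteq> t" for s
    proof -
      have "(x s - x t) /\<^sub>R (s - t) - x' t = (x s - x t - (s - t) *\<^sub>R x' t) /\<^sub>R (s - t)"
        using that by (simp add: scaleR_diff_right)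
      then show ?thesis by (simp add: divide_inverse_commute)
    qed
    ultimately have "((\<lambda>s. norm ((x s - x t) /\<^sub>R (s - t) - x' t)) \<longlongrightarrow> 0) (at t within I)"
      by (elim Lim_transform_eventually) (simp add: eventually_at_filter)
    then have "((\<lambda>s. (x s - x t) /\<^sub>R (s - t) - x' t) \<longlongrightarrow> 0) (at t within I)"
      by (simp only: tendsto_norm_zero_iff)
    from V0[OF this] show ?thesis
      unfolding diff[abs_def] scale[abs_def] by (simp add: diff scale divide_inverse_commute fun_eq_iff)
  qed
  ultimately show ?thesis
    using cV cont by (simp add: L2_C1_deriv_on_def)
qed

lemma L2_C1_deriv_on_diff:
  assumes u: "L2_C1_deriv_on I S u u'" and v: "L2_C1_deriv_on I S v v'"
  shows "L2_C1_deriv_on I S (\<lambda>t x. u t x - v t x) (\<lambda>t x. u' t x - v' t x)"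
proof -
  have conv: "((\<lambda>s. norm_L2 S (\<lambda>x. f s x - g s x)) \<longlongrightarrow> 0) F"
    if "((\<lambda>s. norm_L2 S (f s)) \<longlongrightarrow> 0) F" "((\<lambda>s. norm_L2 S (g s)) \<longlongrightarrow> 0) F"
      and L2: "\<forall>\<^sub>F s in F. f s \<in> L2_space S \<and> g s \<in> L2_space S"
    for f g :: "real \<Rightarrow> 'a \<Rightarrow> real" and F
  proof (rule tendsto_sandwich[where f="\<lambda>_. 0" and h="\<lambda>s. norm_L2 S (f s) + norm_L2 S (g s)"])
    show "\<forall>\<^sub>F s in F. norm_L2 S (\<lambda>x. f s x - g s x) \<le> norm_L2 S (f s) + norm_L2 S (g s)"
      using L2 by eventually_elim (auto intro: L2_diff)
    show "((\<lambda>s. norm_L2 S (f s) + norm_L2 S (g s)) \<longlongrightarrow> 0) F"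
      using tendsto_add[OF that(1,2)] by simp
  qed auto
  have ev: "\<forall>\<^sub>F s in at t within I. s \<in> I" for t by (simp add: eventually_at_filter)
  have c: "L2_continuous_on I S (\<lambda>t x. f t x - g t x)"
    if f: "L2_continuous_on I S f" and g: "L2_continuous_on I S g" for f g :: "real \<Rightarrow> 'a \<Rightarrow> real"
    unfolding L2_continuous_on_def
  proof safe
    fix t assume t: "t \<in> I"
    show "(\<lambda>x. f t x - g t x) \<in> L2_space S"
      using f g t by (auto simp: L2_continuous_on_def intro: L2_diff)
    have "((\<lambda>s. norm_L2 S (\<lambda>x. (f s x - f t x) - (g s x - g t x))) \<longlongrightarrow> 0) (at t within I)"
    proof (rule conv)
      show "\<forall>\<^sub>F s in at t within I. (\<lambda>x. f s x - f t x) \<in> L2_space S \<and> (\<lambda>x. g s x - g t x) \<in> L2_space S"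
        using ev by eventually_elim (use f g t in \<open>auto simp: L2_continuous_on_def intro!: L2_diff\<close>)
    qed (use f g t in \<open>auto simp: L2_continuous_on_def\<close>)
    then show "((\<lambda>s. norm_L2 S (\<lambda>x. f s x - g s x - (f t x - g t x))) \<longlongrightarrow> 0) (at t within I)"
      by (simp add: algebra_simps)
  qed
  have L2: "u t \<in> L2_space S" "v t \<in> L2_space S" "u' t \<in> L2_space S" "v' t \<in> L2_space S" if "t \<in> I" for t
    using u v that by (auto simp: L2_C1_deriv_on_def L2_continuous_on_def)
  have "((\<lambda>s. norm_L2 S (\<lambda>x. (u s x - v s x - (u t x - v t x)) / (s - t) - (u' t x - v' t x))) \<longlongrightarrow> 0) (at t within I)"
    if t: "t \<in> I" for t
  proof -
    have "((\<lambda>s. norm_L2 S (\<lambda>x. ((u s x - u t x) / (s - t) - u' t x) - ((v s x - v t x) / (s - t) - v' t x))) \<longlongrightarrow> 0) (at t within I)"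
    proof (rule conv)
      have q: "(\<lambda>x. (f s x - f t x) / (s - t) - f' x) \<in> L2_space S"
        if "f s \<in> L2_space S" "f t \<in> L2_space S" "f' \<in> L2_space S" for f f' s
        using L2_diff(1)[OF L2_scale(1)[OF L2_diff(1)[OF that(1,2)], of "1 / (s - t)"] that(3)] by simp
      show "\<forall>\<^sub>F s in at t within I. (\<lambda>x. (u s x - u t x) / (s - t) - u' t x) \<in> L2_space S \<and> (\<lambda>x. (v s x - v t x) / (s - t) - v' t x) \<in> L2_space S"
        using ev by eventually_elim (use L2 t in \<open>auto intro!: q\<close>)
    qed (use u v t in \<open>auto simp: L2_C1_deriv_on_def\<close>)
    then show ?thesis
      by (rule back_subst[of "\<lambda>h. (h \<longlongrightarrow> 0) (at t within I)"]) (simp add: diff_divide_distrib add_divide_distrib algebra_simps)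
  qed
  with u v c show ?thesis
    by (auto simp: L2_C1_deriv_on_def)
qed

lemma L2_energy_has_derivative:
  assumes w: "L2_C1_deriv_on I S w w'" and t: "t \<in> I"
  shows "((\<lambda>s. LINT x|lebesgue_on S. (w s x)\<^sup>2) has_real_derivative
            2 * (LINT x|lebesgue_on S. w t x * w' t x)) (at t within I)"
proof -
  have L2: "w s \<in> L2_space S" "w' s \<in> L2_space S" if "s \<in> I" for s
    using w that by (auto simp: L2_C1_deriv_on_def L2_continuous_on_def)
  define q where "q s x = (w s x - w t x) / (s - t) - w' t x" for s x
  define d where "d s x = w s x - w t x" for s x
  have q0: "((\<lambda>s. norm_L2 S (q s)) \<longlongrightarrow> 0) (at t within I)"
    and d0: "((\<lambda>s. norm_L2 S (d s)) \<longlongrightarrow> 0) (at t within I)"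
    using w t by (simp_all add: L2_C1_deriv_on_def L2_continuous_on_def q_def[abs_def] d_def[abs_def])
  have "\<forall>\<^sub>F s in at t within I. norm (((LINT x|lebesgue_on S. (w s x)\<^sup>2) - (LINT x|lebesgue_on S. (w t x)\<^sup>2)) / (s - t) - 2 * (LINT x|lebesgue_on S. w t x * w' t x))
       \<le> 2 * (norm_L2 S (w t) * norm_L2 S (q s)) + norm_L2 S (d s) * norm_L2 S (q s) + norm_L2 S (d s) * norm_L2 S (w' t)"
    unfolding eventually_at_filter
  proof (intro always_eventually allI impI)
    fix s assume s: "s \<noteq> t" "s \<in> I"
    have d: "d s \<in> L2_space S" unfolding d_def by (intro L2_diff L2 s t)
    have q: "q s \<in> L2_space S"
      using L2_diff(1)[OF L2_scale(1)[OF d, of "1 / (s - t)"] L2(2)[OF t]] by (simp add: q_def[abs_def] d_def)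
    have eq: "((w s x)\<^sup>2 - (w t x)\<^sup>2) / (s - t)  - 2 * (w t x * w' t x) = 2 * (w t x * q s x) + d s x * q s x + d s x * w' t x" for x
    proof -
      have sq: "(w s x)\<^sup>2 - (w t x)\<^sup>2 = d s x * (2 * w t x + d s x)"
        by (simp add: d_def power2_eq_square algebra_simps)
      have "((w s x)\<^sup>2 - (w t x)\<^sup>2) / (s - t) = d s x / (s - t) * (2 * w t x + d s x)"
        unfolding sq by (rule times_divide_eq_left[symmetric])
      also have "d s x / (s - t) = q s x + w' t x"
        by (simp add: q_def d_def)
      finally have "((w s x)\<^sup>2 - (w t x)\<^sup>2) / (s - t) = (q s x + w' t x) * (2 * w t x + d s x)" .
      moreover have "(Q + W') * (2 * W + D) - 2 * (W * W') = 2 * (W * Q) + D * Q + D * W'" for Q W W' D :: real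
        by (simp add: algebra_simps)
      ultimately show ?thesis by presburger
    qed
    note int = L2_mult_integrable L2_space_square_integrable
    have "((LINT x|lebesgue_on S. (w s x)\<^sup>2) - (LINT x|lebesgue_on S. (w t x)\<^sup>2)) / (s - t) - 2 * (LINT x|lebesgue_on S. w t x * w' t x)
      = (LINT x|lebesgue_on S. ((w s x)\<^sup>2 - (w t x)\<^sup>2) / (s - t)  - 2 * (w t x * w' t x))"
      using s t L2 by (simp add: int)
    also have "\<dots> = 2 * (LINT x|lebesgue_on S. w t x * q s x) + (LINT x|lebesgue_on S. d s x * q s x) + (LINT x|lebesgue_on S. d s x * w' t x)"
      unfolding eq using s t L2 d q by (simp add: int)
    finally have *: "((LINT x|lebesgue_on S. (w s x)\<^sup>2) - (LINT x|lebesgue_on S. (w t x)\<^sup>2)) / (s - t) - 2 * (LINT x|lebesgue_on S. w t x * w' t x) = \<dots>" .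
    show "norm (((LINT x|lebesgue_on S. (w s x)\<^sup>2) - (LINT x|lebesgue_on S. (w t x)\<^sup>2)) / (s - t) - 2 * (LINT x|lebesgue_on S. w t x * w' t x))
       \<le> 2 * (norm_L2 S (w t) * norm_L2 S (q s)) + norm_L2 S (d s) * norm_L2 S (q s) + norm_L2 S (d s) * norm_L2 S (w' t)"
      unfolding * using L2_Cauchy_Schwarz[OF L2(1)[OF t] q] L2_Cauchy_Schwarz[OF d q] L2_Cauchy_Schwarz[OF d L2(2)[OF t]]
      by (simp add: abs_le_iff)
  qed
  \<comment> \<open>The three terms of the bound vanish because \<open>q\<close> and \<open>d\<close> tend to 0 in norm.\<close>
  note bound = this
  have "((\<lambda>s. 2 * (norm_L2 S (w t) * norm_L2 S (q s)) + norm_L2 S (d s) * norm_L2 S (q s) + norm_L2 S (d s) * norm_L2 S (w' t)) \<longlongrightarrow> 2 * (norm_L2 S (w t) * 0) + 0 * 0 + 0 * norm_L2 S (w' t)) (at t within I)"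
    by (intro tendsto_intros q0 d0)
  also have "2 * (norm_L2 S (w t) * 0) + 0 * 0 + 0 * norm_L2 S (w' t) = 0" by simp
  finally have "((\<lambda>s. ((LINT x|lebesgue_on S. (w s x)\<^sup>2) - (LINT x|lebesgue_on S. (w t x)\<^sup>2)) / (s - t) - 2 * (LINT x|lebesgue_on S. w t x * w' t x)) \<longlongrightarrow> 0) (at t within I)"
    by (rule Lim_null_comparison[OF bound])
  then show ?thesis
    unfolding has_field_derivative_iff by (rule LIM_zero_cancel)
qed

section \<open>Differential equations\<close>

text \<open>
  The bound on \<open>\<bar>E'\<bar>\<close> controls \<open>E\<close> forwards and backwards in time.
\<close>

lemma Gronwall_two_sided:
  fixes E :: "real \<Rightarrow> real"
  assumes der: "\<And>t. (E has_real_derivative E' t) (at t)"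
    and bd: "\<And>t. \<bar>t\<bar> \<le> T \<Longrightarrow> \<bar>E' t\<bar> \<le> C * E t + r"
    and E0: "E 0 = 0" and C: "C > 0" and t: "\<bar>t\<bar> \<le> T"
  shows "E t \<le> r / C * exp (C * T)"
proof -
  have r: "r \<ge> 0" using bd[of 0] E0 t abs_ge_zero[of t] abs_ge_zero[of "E' 0"] by auto
  have "E t + r / C \<le> r / C * exp (C * \<bar>t\<bar>)"
  proof (cases "t \<ge> 0")
    case True
    have "exp (- C * t) * (E t + r / C) \<le> exp (- C * 0) * (E 0 + r / C)"
    proof (rule DERIV_nonpos_imp_nonincreasing[OF True])
      fix s assume s: "0 \<le> s" "s \<le> t"
      have "((\<lambda>s. exp (- C * s) * (E s + r / C)) has_real_derivative exp (- C * s) * (E' s - (C * E s + r))) (at s)"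
        using C by (auto intro!: derivative_eq_intros der simp: field_simps)
      moreover have "exp (- C * s) * (E' s - (C * E s + r)) \<le> 0"
        using bd[of s] s t by (intro mult_nonneg_nonpos) auto
      ultimately show "\<exists>y. ((\<lambda>s. exp (- C * s) * (E s + r / C)) has_real_derivative y) (at s) \<and> y \<le> 0"
        by blast
    qed
    then show ?thesis using True E0 by (simp add: exp_minus field_simps)
  next
    case False
    then have t0: "t \<le> 0" by simp
    have "exp (C * t) * (E t + r / C) \<le> exp (C * 0) * (E 0 + r / C)"
    proof (rule DERIV_nonneg_imp_nondecreasing[OF t0])
      fix s assume s: "t \<le> s" "s \<le> 0"
      have "((\<lambda>s. exp (C * s) * (E s + r / C)) has_real_derivative exp (C * s) * (E' s + (C * E s + r))) (at s)"
        using C by (auto intro!: derivative_eq_intros der simp: field_simps)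
      moreover have "exp (C * s) * (E' s + (C * E s + r)) \<ge> 0"
        using bd[of s] s t by (intro mult_nonneg_nonneg) auto
      ultimately show "\<exists>y. ((\<lambda>s. exp (C * s) * (E s + r / C)) has_real_derivative y) (at s) \<and> y \<ge> 0"
        by blast
    qed
    then have "exp (- C * t) * (exp (C * t) * (E t + r / C)) \<le> exp (- C * t) * (r / C)"
      using E0 by (intro mult_left_mono) auto
    moreover have "exp (- C * t) * exp (C * t) = 1"
      by (simp add: exp_minus)
    ultimately have "E t + r / C \<le> exp (- C * t) * (r / C)"
      by (metis mult.assoc mult_1)
    then show ?thesis using False by (simp add: mult.commute)
  qed
  also have "\<dots> \<le> r / C * exp (C * T)"
    using r C t by (intro mult_left_mono) auto
  finally show ?thesis
    using divide_nonneg_pos[OF r C] by linarith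
qed

text \<open>
  The integral of \<open>h\<close> from 0 to \<open>t\<close>, with the usual sign for negative \<open>t\<close>: one of the two intervals is
  empty or a point.
\<close>

definition oriented_integral :: "(real \<Rightarrow> 'b::banach) \<Rightarrow> real \<Rightarrow> 'b" where
  "oriented_integral h t = integral {0..t} h - integral {t..0} h"

lemma oriented_integral_0 [simp]: "oriented_integral h 0 = 0"
  by (simp add: oriented_integral_def)

lemma oriented_integral_has_vector_derivative:
  assumes h: "continuous_on UNIV h"
  shows "(oriented_integral h has_vector_derivative h t) (at t)"
proof -
  define n where "n = \<bar>t\<bar> + 1"
  have int: "h integrable_on {c..d}" for c d
    using h by (intro integrable_continuous_interval) (auto intro: continuous_on_subset)
  have eq: "oriented_integral h s = integral {-n..s} h - integral {-n..0} h" if "s \<in> {-n<..<n}" for s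
  proof (cases "s \<ge> 0")
    case True
    moreover have "integral {s..0} h = 0"
      using True by (cases "s = 0") auto
    moreover have "integral {-n..0} h + integral {0..s} h = integral {-n..s} h"
      using True that int by (intro Henstock_Kurzweil_Integration.integral_combine) (auto simp: n_def)
    ultimately show ?thesis by (simp add: oriented_integral_def algebra_simps)
  next
    case False
    moreover have "integral {-n..s} h + integral {s..0} h = integral {-n..0} h"
      using False that int by (intro Henstock_Kurzweil_Integration.integral_combine) auto
    ultimately show ?thesis by (simp add: oriented_integral_def algebra_simps)
  qed
  have "((\<lambda>s. integral {-n..s} h) has_vector_derivative h t) (at t within {-n..n})"
    using h by (intro integral_has_vector_derivative) (auto simp: n_def intro: continuous_on_subset)
  then have "((\<lambda>s. integral {-n..s} h) has_vector_derivative h t) (at t within {-n<..<n})"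
    by (rule has_vector_derivative_within_subset) auto
  then have "((\<lambda>s. integral {-n..s} h) has_vector_derivative h t) (at t)"
    by (subst (asm) has_vector_derivative_within_open) (auto simp: n_def)
  then have "((\<lambda>s. integral {-n..s} h - integral {-n..0} h) has_vector_derivative h t - 0) (at t)"
    by (intro has_vector_derivative_diff has_vector_derivative_const)
  then show ?thesis
    unfolding diff_0_right
    by (rule has_vector_derivative_transform_within_open[where S="{-n<..<n}"])
      (auto simp: n_def eq)
qed

lemma oriented_integral_exp_bound:
  assumes h: "continuous_on UNIV h" and bd: "\<And>s. norm (h s) \<le> K * exp (\<mu> * \<bar>s\<bar>)"
    and l: "\<mu> > 0"
  shows "norm (oriented_integral h t) \<le> K / \<mu> * exp (\<mu> * \<bar>t\<bar>)"
proof -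
  have K: "K \<ge> 0" using bd[of 0] norm_ge_zero[of "h 0"] by (simp del: norm_ge_zero)
  have int: "h integrable_on {c..d}" for c d
    using h by (intro integrable_continuous_interval) (auto intro: continuous_on_subset)
  have *: "K / \<mu> * (exp (\<mu> * \<bar>t\<bar>) - 1) \<le> K / \<mu> * exp (\<mu> * \<bar>t\<bar>)"
    using K l by (intro mult_left_mono) auto
  show ?thesis
  proof (cases "t \<ge> 0")
    case True
    have I: "((\<lambda>s. K * exp (\<mu> * s)) has_integral (K / \<mu> * exp (\<mu> * t) - K / \<mu> * exp (\<mu> * 0))) {0..t}"
      using True l by (intro fundamental_theorem_of_calculus)
        (auto intro!: derivative_eq_intros simp: has_real_derivative_iff_has_vector_derivative[symmetric])
    have "norm (integral {0..t} h) \<le> integral {0..t} (\<lambda>s. K * exp (\<mu> * s))"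
      using bd I int by (intro Henstock_Kurzweil_Integration.integral_norm_bound_integral) (auto, metis abs_of_nonneg)
    also have "\<dots> = K / \<mu> * (exp (\<mu> * \<bar>t\<bar>) - 1)"
      using integral_unique[OF I] True by (simp add: algebra_simps)
    finally show ?thesis
      using * True by (cases "t = 0") (auto simp: oriented_integral_def)
  next
    case False
    have I: "((\<lambda>s. K * exp (- \<mu> * s)) has_integral (- K / \<mu> * exp (- \<mu> * 0) - (- K / \<mu>) * exp (- \<mu> * t))) {t..0}"
      using False l by (intro fundamental_theorem_of_calculus)
        (auto intro!: derivative_eq_intros simp: has_real_derivative_iff_has_vector_derivative[symmetric])
    have "norm (integral {t..0} h) \<le> integral {t..0} (\<lambda>s. K * exp (- \<mu> * s))"
    proof (intro Henstock_Kurzweil_Integration.integral_norm_bound_integral int)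
      show "(\<lambda>s. K * exp (- \<mu> * s)) integrable_on {t..0}" using I by blast
      show "norm (h s) \<le> K * exp (- \<mu> * s)" if "s \<in> {t..0}" for s
        using bd[of s] that by (simp add: abs_of_nonpos)
    qed
    also have "\<dots> = K / \<mu> * (exp (\<mu> * \<bar>t\<bar>) - 1)"
      using integral_unique[OF I] False by (simp add: algebra_simps)
    finally show ?thesis
      using * False by (auto simp: oriented_integral_def)
  qed
qed

text \<open>
  Picard iteration on the whole time axis at once. The unknown is the bounded continuous function \<open>r\<close> with
  \<open>x t = x0 + exp (\<mu> \<bar>t\<bar>) r t\<close>; the exponential weight makes the integral operator a contraction.
\<close>

theorem global_Lipschitz_ode_solution:
  fixes f :: "'b::banach \<Rightarrow> 'b"
  assumes L: "L-lipschitz_on UNIV f"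
  obtains x where "x 0 = x0" "\<And>t. (x has_vector_derivative f (x t)) (at t)"
proof -
  \<comment> \<open>This weight gives the contraction factor \<open>L / \<mu> \<le> 1 / 2\<close>.\<close>
  define \<mu> where "\<mu> = 2 * L + 1"
  have L0: "L \<ge> 0" using L lipschitz_on_nonneg by blast
  have l: "\<mu> > 0" using L0 by (simp add: \<mu>_def)
  have fcont: "continuous_on UNIV f" using L by (rule lipschitz_on_continuous_on)
  have fL: "norm (f a - f b) \<le> L * norm (a - b)" for a b
    using lipschitz_onD[OF L, of a b] by (simp add: dist_norm)
  define w where "w t = exp (\<mu> * \<bar>t\<bar>)" for t :: real
  have w1: "w t \<ge> 1" and w0: "w t > 0" for t using l by (auto simp: w_def)
  have wcont: "continuous_on UNIV w" unfolding w_def by (intro continuous_intros)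
  define h where "h r s = f (x0 + w s *\<^sub>R apply_bcontfun r s)" for r :: "real \<Rightarrow>\<^sub>C 'b" and s
  have hcont: "continuous_on UNIV (h r)" for r
    unfolding h_def
    by (intro continuous_on_compose2[OF fcont] continuous_intros wcont) auto
  have hbd: "norm (h r s) \<le> (norm (f x0) + L * norm r) * exp (\<mu> * \<bar>s\<bar>)" for r s
  proof -
    have "norm (h r s) \<le> norm (f x0) + norm (h r s - f x0)"
      by (metis add.commute diff_add_cancel norm_triangle_ineq)
    also have "norm (h r s - f x0) \<le> L * (w s * norm r)"
      using fL[of "x0 + w s *\<^sub>R apply_bcontfun r s" x0] norm_bounded[of r s] w0[of s] L0
      by (auto simp: h_def intro!: order_trans[OF fL] mult_left_mono)
    also have "norm (f x0) \<le> norm (f x0) * w s"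
      using w1[of s] mult_left_mono[of 1 "w s" "norm (f x0)"] by simp
    finally show ?thesis by (simp add: w_def algebra_simps)
  qed
  define T where "T r = Bcontfun (\<lambda>t. oriented_integral (h r) t /\<^sub>R w t)" for r
  have T: "apply_bcontfun (T r) t = oriented_integral (h r) t /\<^sub>R w t" for r t
  proof -
    have "continuous_on UNIV (oriented_integral (h r))"
      using oriented_integral_has_vector_derivative[OF hcont]
      by (meson continuous_at_imp_continuous_on has_vector_derivative_continuous)
    then have "continuous_on UNIV (\<lambda>t. oriented_integral (h r) t /\<^sub>R w t)"
      using w0 by (intro continuous_intros wcont) (auto simp: less_imp_neq[THEN not_sym])
    moreover have "norm (oriented_integral (h r) t /\<^sub>R w t) \<le> (norm (f x0) + L * norm r) / \<mu>" for t
      using oriented_integral_exp_bound[OF hcont hbd l, of r t] w0[of t]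
      by (simp add: w_def field_simps)
    ultimately show ?thesis
      unfolding T_def by (subst Bcontfun_inverse) (rule bcontfun_normI, assumption+, rule refl)
  qed
  have contr: "dist (T r) (T r') \<le> (1/2) * dist r r'" for r r'
  proof (rule dist_bound)
    fix t
    have "norm (h r s - h r' s) \<le> L * dist r r' * exp (\<mu> * \<bar>s\<bar>)" for s
    proof -
      have "norm (h r s - h r' s) \<le> L * (w s * norm (apply_bcontfun r s - apply_bcontfun r' s))"
        unfolding h_def using w0[of s]
        by (intro order_trans[OF fL]) (simp add: scaleR_diff_right[symmetric] del: scaleR_diff_right)
      also have "\<dots> \<le> L * (w s * dist r r')"
        using dist_bounded[of r s r'] L0 w0[of s] by (intro mult_left_mono) (auto simp: dist_norm)
      finally show ?thesis by (simp add: w_def mult_ac)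
    qed
    then have *: "norm (oriented_integral (\<lambda>s. h r s - h r' s) t) \<le> L * dist r r' / \<mu> * exp (\<mu> * \<bar>t\<bar>)"
      by (intro oriented_integral_exp_bound l continuous_intros hcont)
    have int: "h r integrable_on {c..d}" for r c d
      using hcont by (intro integrable_continuous_interval) (auto intro: continuous_on_subset)
    have "oriented_integral (\<lambda>s. h r s - h r' s) t = oriented_integral (h r) t - oriented_integral (h r') t"
      using int by (simp add: oriented_integral_def Henstock_Kurzweil_Integration.integral_diff)
    then have "dist (T r t) (T r' t) = norm (oriented_integral (\<lambda>s. h r s - h r' s) t) / w t"
      using w0[of t] by (simp add: T dist_norm scaleR_diff_right[symmetric] divide_inverse_commute del: scaleR_diff_right)
    also have "\<dots> \<le> L / \<mu> * dist r r'"
      using * w0[of t] by (simp add: w_def field_simps)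
    also have "\<dots> \<le> 1/2 * dist r r'"
      using L0 by (intro mult_right_mono) (auto simp: \<mu>_def field_simps)
    finally show "dist (T r t) (T r' t) \<le> (1/2) * dist r r'" .
  qed
  obtain r where r: "T r = r"
    using banach_fix_type[of "1/2" T] contr by (auto simp: Ex1_def)
  define x where "x t = x0 + w t *\<^sub>R apply_bcontfun r t" for t
  have x_eq: "x = (\<lambda>t. x0 + oriented_integral (h r) t)"
    using T[of r, unfolded r] w0 by (auto simp: x_def less_imp_neq[THEN not_sym])
  show thesis
  proof (rule that)
    show "x 0 = x0" by (simp add: x_eq)
    show "(x has_vector_derivative f (x t)) (at t)" for t
    proof -
      have "(x has_vector_derivative 0 + h r t) (at t)"
        unfolding x_eq
        by (intro has_vector_derivative_add has_vector_derivative_const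
            oriented_integral_has_vector_derivative hcont)
      then show ?thesis by (simp add: h_def x_def)
    qed
  qed
qed

section \<open>Weak convergence, uniformly over compact families of test functions\<close>

lemma tendsto_integral_dominated_within:
  fixes f :: "'i::metric_space \<Rightarrow> 'a \<Rightarrow> real"
  assumes meas: "\<And>i. i \<in> S \<Longrightarrow> f i \<in> borel_measurable M" "l \<in> borel_measurable M"
    and h: "integrable M h" and bd: "\<And>i. i \<in> S \<Longrightarrow> AE y in M. \<bar>f i y\<bar> \<le> h y"
    and lim: "AE y in M. ((\<lambda>i. f i y) \<longlongrightarrow> l y) (at a within S)"
  shows "((\<lambda>i. \<integral>y. f i y \<partial>M) \<longlongrightarrow> (\<integral>y. l y \<partial>M)) (at a within S)"
  unfolding tendsto_at_iff_sequentially
proof (intro allI impI)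
  fix X assume X: "\<forall>n. X n \<in> S - {a}" "X \<longlonglongrightarrow> a"
  show "((\<lambda>i. \<integral>y. f i y \<partial>M) \<circ> X) \<longlonglongrightarrow> (\<integral>y. l y \<partial>M)"
    unfolding comp_def
  proof (rule integral_dominated_convergence[where w=h])
    show "AE y in M. (\<lambda>n. f (X n) y) \<longlonglongrightarrow> l y"
      using lim by eventually_elim (use X in \<open>auto simp: tendsto_at_iff_sequentially comp_def\<close>)
  qed (use X meas h bd in auto)
qed

lemma continuous_on_integral_dominated:
  fixes f :: "'i::metric_space \<Rightarrow> 'a \<Rightarrow> real"
  assumes meas: "\<And>i. i \<in> S \<Longrightarrow> f i \<in> borel_measurable M"
    and h: "integrable M h" and bd: "\<And>i. i \<in> S \<Longrightarrow> AE y in M. \<bar>f i y\<bar> \<le> h y"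
    and cont: "\<And>i. i \<in> S \<Longrightarrow> AE y in M. ((\<lambda>j. f j y) \<longlongrightarrow> f i y) (at i within S)"
  shows "continuous_on S (\<lambda>i. \<integral>y. f i y \<partial>M)"
  unfolding continuous_on_def
  by (intro ballI tendsto_integral_dominated_within[OF meas _ h bd cont]) (use meas in auto)

text \<open>
  By domination and almost everywhere continuity, \<open>i \<mapsto> \<Phi> i\<close> is continuous into \<open>L\<^sup>1\<close>, so the family is
  compact there. The convergence on a finite net extends to the family because the weights are bounded.
\<close>

lemma uniform_limit_weak_convergence:
  fixes \<Phi> :: "'i::metric_space \<Rightarrow> 'a \<Rightarrow> real" and \<psi> :: "'e \<Rightarrow> 'a \<Rightarrow> real"
  assumes S: "compact S"
    and meas: "\<And>i. i \<in> S \<Longrightarrow> \<Phi> i \<in> borel_measurable M"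
    and h: "integrable M h" and bd: "\<And>i. i \<in> S \<Longrightarrow> AE y in M. \<bar>\<Phi> i y\<bar> \<le> h y"
    and cont: "\<And>i. i \<in> S \<Longrightarrow> AE y in M. ((\<lambda>j. \<Phi> j y) \<longlongrightarrow> \<Phi> i y) (at i within S)"
    and \<psi>: "\<forall>\<^sub>F e in F. \<psi> e \<in> borel_measurable M \<and> (AE y in M. \<bar>\<psi> e y\<bar> \<le> C)"
    and X: "X \<in> borel_measurable M" "AE y in M. \<bar>X y\<bar> \<le> C"
    and C: "C > 0"
    and weak: "\<And>\<phi>. integrable M \<phi> \<Longrightarrow> ((\<lambda>e. \<integral>y. \<psi> e y * \<phi> y \<partial>M) \<longlongrightarrow> (\<integral>y. X y * \<phi> y \<partial>M)) F"
  shows "uniform_limit S (\<lambda>e i. \<integral>y. \<psi> e y * \<Phi> i y \<partial>M) (\<lambda>i. \<integral>y. X y * \<Phi> i y \<partial>M) F"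
proof (rule uniform_limitI)
  fix r :: real assume r: "r > 0"
  define D where "D i j = (\<integral>y. \<bar>\<Phi> j y - \<Phi> i y\<bar> \<partial>M)" for i j
  have int: "integrable M (\<Phi> i)" if "i \<in> S" for i
    by (rule Bochner_Integration.integrable_bound[OF h]) (use meas bd[OF that] that in auto)
  have close: "\<bar>(\<integral>y. \<rho> y * \<Phi> j y \<partial>M) - (\<integral>y. \<rho> y * \<Phi> i y \<partial>M)\<bar> \<le> C * D i j"
    if \<rho>: "\<rho> \<in> borel_measurable M" "AE y in M. \<bar>\<rho> y\<bar> \<le> C" and ij: "i \<in> S" "j \<in> S" for \<rho> i j
  proof -
    have int\<rho>: "integrable M (\<lambda>y. \<rho> y * \<phi> y)" if "integrable M \<phi>" for \<phi>
    proof (rule Bochner_Integration.integrable_bound)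
      show "integrable M (\<lambda>y. C * \<phi> y)" using that by simp
      show "AE y in M. norm (\<rho> y * \<phi> y) \<le> norm (C * \<phi> y)"
        using \<rho>(2) by eventually_elim (use C in \<open>auto simp: abs_mult intro!: mult_right_mono\<close>)
    qed (use \<rho> that in measurable)
    have "(\<integral>y. \<rho> y * \<Phi> j y \<partial>M) - (\<integral>y. \<rho> y * \<Phi> i y \<partial>M) = (\<integral>y. \<rho> y * (\<Phi> j y - \<Phi> i y) \<partial>M)"
      using int[OF ij(1)] int[OF ij(2)] by (simp add: int\<rho> right_diff_distrib)
    moreover have "\<bar>\<integral>y. \<rho> y * (\<Phi> j y - \<Phi> i y) \<partial>M\<bar> \<le> (\<integral>y. C * \<bar>\<Phi> j y - \<Phi> i y\<bar> \<partial>M)"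
    proof (rule order_trans[OF integral_abs_bound], rule integral_mono_AE)
      show "AE y in M. \<bar>\<rho> y * (\<Phi> j y - \<Phi> i y)\<bar> \<le> C * \<bar>\<Phi> j y - \<Phi> i y\<bar>"
        using \<rho>(2) by eventually_elim (auto simp: abs_mult intro!: mult_right_mono)
    qed (use int ij in \<open>auto intro!: int\<rho>\<close>)
    ultimately show ?thesis by (simp add: D_def)
  qed
  define \<eta> where "\<eta> = r / (3 * C)"
  have \<eta>: "\<eta> > 0" "C * \<eta> = r / 3" using r C by (auto simp: \<eta>_def)
  have "\<exists>d>0. \<forall>j\<in>S. dist j i < d \<longrightarrow> D i j < \<eta>" if i: "i \<in> S" for i
  proof -
    have "((\<lambda>j. \<integral>y. \<bar>\<Phi> j y - \<Phi> i y\<bar> \<partial>M) \<longlongrightarrow> (\<integral>y. 0 \<partial>M)) (at i within S)"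
    proof (rule tendsto_integral_dominated_within[where h="\<lambda>y. 2 * h y"])
      show "AE y in M. \<bar>\<bar>\<Phi> j y - \<Phi> i y\<bar>\<bar> \<le> 2 * h y" if "j \<in> S" for j
        using bd[OF that] bd[OF i] by eventually_elim auto
      show "AE y in M. ((\<lambda>j. \<bar>\<Phi> j y - \<Phi> i y\<bar>) \<longlongrightarrow> 0) (at i within S)"
        using cont[OF i] by eventually_elim (simp add: LIM_zero tendsto_rabs_zero)
    qed (use meas i h in auto)
    then have "\<forall>\<^sub>F j in at i within S. D i j < \<eta>"
      unfolding D_def using \<eta> order_tendstoD(2) by fastforce
    then obtain d where d: "d > 0" "\<And>j. j \<in> S \<Longrightarrow> j \<noteq> i \<Longrightarrow> dist j i < d \<Longrightarrow> D i j < \<eta>"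
      by (auto simp: eventually_at)
    have "D i i < \<eta>" using \<eta> by (simp add: D_def)
    with d show ?thesis by metis
  qed
  then obtain d where d: "\<And>i. i \<in> S \<Longrightarrow> d i > 0"
    "\<And>i j. i \<in> S \<Longrightarrow> j \<in> S \<Longrightarrow> dist j i < d i \<Longrightarrow> D i j < \<eta>" by metis
  have "S \<subseteq> (\<Union>i\<in>S. ball i (d i))" using d(1) by force
  then obtain T where T: "T \<subseteq> S" "finite T" "S \<subseteq> (\<Union>i\<in>T. ball i (d i))"
    by (rule compactE_image[OF S, rotated]) auto
  have "\<forall>\<^sub>F e in F. \<forall>i\<in>T. \<bar>(\<integral>y. \<psi> e y * \<Phi> i y \<partial>M) - (\<integral>y. X y * \<Phi> i y \<partial>M)\<bar> < r / 3"
  proof (intro eventually_ball_finite T ballI)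
    fix i assume "i \<in> T"
    then have "((\<lambda>e. \<integral>y. \<psi> e y * \<Phi> i y \<partial>M) \<longlongrightarrow> (\<integral>y. X y * \<Phi> i y \<partial>M)) F"
      using T by (intro weak int) auto
    from tendstoD[OF this, of "r / 3"] r
    show "\<forall>\<^sub>F e in F. \<bar>(\<integral>y. \<psi> e y * \<Phi> i y \<partial>M) - (\<integral>y. X y * \<Phi> i y \<partial>M)\<bar> < r / 3"
      by (simp add: dist_real_def)
  qed
  with \<psi> show "\<forall>\<^sub>F e in F. \<forall>i\<in>S. dist (\<integral>y. \<psi> e y * \<Phi> i y \<partial>M) (\<integral>y. X y * \<Phi> i y \<partial>M) < r"
  proof eventually_elim
    case (elim e)
    show ?case
    proof
      fix j assume j: "j \<in> S"
      then obtain i where i: "i \<in> T" "dist j i < d i"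
        using T(3) by (auto simp: dist_commute)
      then have "D i j < \<eta>" using d(2) j T by auto
      then have "C * D i j < r / 3" using C \<eta>(2) mult_strict_left_mono by fastforce
      moreover have iS: "i \<in> S" using i T by auto
      moreover note close[of "\<psi> e" i j] close[OF X iS j]
      moreover have "\<bar>(\<integral>y. \<psi> e y * \<Phi> i y \<partial>M) - (\<integral>y. X y * \<Phi> i y \<partial>M)\<bar> < r / 3"
        using elim i by blast
      ultimately show "dist (\<integral>y. \<psi> e y * \<Phi> j y \<partial>M) (\<integral>y. X y * \<Phi> j y \<partial>M) < r"
        using elim j unfolding dist_real_def by argo
    qed
  qed
qed

section \<open>Measurability and weak* convergence of time-dependent functions\<close>

text \<open>
  An almost everywhere limit is measurable here because Lebesgue measure is complete.
\<close>

lemma borel_measurable_lebesgue_on_AE_LIMSEQ: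
  fixes f :: "'a::euclidean_space \<Rightarrow> real"
  assumes S: "S \<in> sets lebesgue" and meas: "\<And>n. s n \<in> borel_measurable (lebesgue_on S)"
    and lim: "AE x in lebesgue_on S. (\<lambda>n. s n x) \<longlonglongrightarrow> f x"
  shows "f \<in> borel_measurable (lebesgue_on S)"
proof -
  define l where "l x = lim (\<lambda>n. indicator S x *\<^sub>R s n x)" for x
  have "l \<in> borel_measurable lebesgue"
    unfolding l_def[abs_def]
    using meas S by (intro borel_measurable_lim_metric) (simp add: borel_measurable_restrict_space_iff)
  moreover have "AE x in lebesgue. l x = indicator S x *\<^sub>R f x"
    using lim S
    by (auto simp: AE_restrict_space_iff l_def indicator_def intro: limI elim!: eventually_mono)
  ultimately have "(\<lambda>x. indicator S x *\<^sub>R f x) \<in> borel_measurable lebesgue"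
    by (rule borel_measurable_AE)
  then show ?thesis using S by (simp add: borel_measurable_restrict_space_iff)
qed

lemma L2_inner_tendsto:
  assumes conv: "(\<lambda>n. norm_L2 S (\<lambda>x. f n x - f0 x)) \<longlonglongrightarrow> 0" "(\<lambda>n. norm_L2 S (\<lambda>x. g n x - g0 x)) \<longlonglongrightarrow> 0"
    and L2: "\<And>n. f n \<in> L2_space S" "f0 \<in> L2_space S" "\<And>n. g n \<in> L2_space S" "g0 \<in> L2_space S"
  shows "(\<lambda>n. LINT x|lebesgue_on S. f n x * g n x) \<longlonglongrightarrow> (LINT x|lebesgue_on S. f0 x * g0 x)"
proof -
  note d = L2_diff(1)[OF L2(1,2)] L2_diff(1)[OF L2(3,4)]
  have "\<bar>(LINT x|lebesgue_on S. f n x * g n x) - (LINT x|lebesgue_on S. f0 x * g0 x)\<bar>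
    \<le> norm_L2 S (\<lambda>x. f n x - f0 x) * norm_L2 S (\<lambda>x. g n x - g0 x)
      + norm_L2 S (\<lambda>x. f n x - f0 x) * norm_L2 S g0 + norm_L2 S f0 * norm_L2 S (\<lambda>x. g n x - g0 x)" for n
  proof -
    have "(LINT x|lebesgue_on S. f n x * g n x) - (LINT x|lebesgue_on S. f0 x * g0 x)
      = (LINT x|lebesgue_on S. f n x * g n x - f0 x * g0 x)"
      using L2 by (simp add: L2_mult_integrable)
    also have "\<dots> = (LINT x|lebesgue_on S. (f n x - f0 x) * (g n x - g0 x) + (f n x - f0 x) * g0 x + f0 x * (g n x - g0 x))"
      by (intro Bochner_Integration.integral_cong) (auto simp: algebra_simps)
    also have "\<dots> = (LINT x|lebesgue_on S. (f n x - f0 x) * (g n x - g0 x)) + (LINT x|lebesgue_on S. (f n x - f0 x) * g0 x) + (LINT x|lebesgue_on S. f0 x * (g n x - g0 x))"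
      using L2_mult_integrable[OF d, of n n] L2_mult_integrable[OF d(1)[of n] L2(4)]
        L2_mult_integrable[OF L2(2) d(2)[of n]] by simp
    finally show ?thesis
      using L2_Cauchy_Schwarz[OF d, of n n] L2_Cauchy_Schwarz[OF d(1)[of n] L2(4)]
        L2_Cauchy_Schwarz[OF L2(2) d(2)[of n]] by linarith
  qed
  note bound = this
  have "(\<lambda>n. norm_L2 S (\<lambda>x. f n x - f0 x) * norm_L2 S (\<lambda>x. g n x - g0 x)
      + norm_L2 S (\<lambda>x. f n x - f0 x) * norm_L2 S g0 + norm_L2 S f0 * norm_L2 S (\<lambda>x. g n x - g0 x)) \<longlonglongrightarrow> 0 * 0 + 0 * norm_L2 S g0 + norm_L2 S f0 * 0"
    by (intro tendsto_intros conv)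
  also have "0 * 0 + 0 * norm_L2 S g0 + norm_L2 S f0 * 0 = 0" by simp
  finally have "(\<lambda>n. (LINT x|lebesgue_on S. f n x * g n x) - (LINT x|lebesgue_on S. f0 x * g0 x)) \<longlonglongrightarrow> 0"
    by (rule Lim_null_comparison[rotated]) (use bound in auto)
  then show ?thesis by (rule LIM_zero_cancel)
qed

lemma L2_strongly_measurable_inner:
  assumes u: "L2_strongly_measurable a b S u" and v: "L2_strongly_measurable a b S v"
  shows "(\<lambda>t. LINT x|lebesgue_on S. u t x * v t x) \<in> borel_measurable (lebesgue_on {a..b})"
proof -
  obtain s where s: "\<And>n. simple_function (lebesgue_on {a..b}) (s n)" "\<And>n t. t \<in> {a..b} \<Longrightarrow> s n t \<in> L2_space S"
    "AE t in lebesgue_on {a..b}. (\<lambda>n. norm_L2 S (\<lambda>x. s n t x - u t x)) \<longlonglongrightarrow> 0"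
    using u unfolding L2_strongly_measurable_def by blast
  obtain r where r: "\<And>n. simple_function (lebesgue_on {a..b}) (r n)" "\<And>n t. t \<in> {a..b} \<Longrightarrow> r n t \<in> L2_space S"
    "AE t in lebesgue_on {a..b}. (\<lambda>n. norm_L2 S (\<lambda>x. r n t x - v t x)) \<longlonglongrightarrow> 0"
    using v unfolding L2_strongly_measurable_def by blast
  show ?thesis
  proof (rule borel_measurable_lebesgue_on_AE_LIMSEQ)
    show "(\<lambda>t. LINT x|lebesgue_on S. s n t x * r n t x) \<in> borel_measurable (lebesgue_on {a..b})" for n
      by (intro borel_measurable_simple_function
          simple_function_compose2[OF s(1) r(1), of "\<lambda>f g. LINT x|lebesgue_on S. f x * g x"])
    have "AE t in lebesgue_on {a..b}. t \<in> {a..b}" by (rule AE_I2) simp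
    with s(3) r(3) show "AE t in lebesgue_on {a..b}. (\<lambda>n. LINT x|lebesgue_on S. s n t x * r n t x) \<longlonglongrightarrow> (LINT x|lebesgue_on S. u t x * v t x)"
    proof eventually_elim
      case (elim t)
      then show ?case
        using u v s(2) r(2) by (intro L2_inner_tendsto) (auto simp: L2_strongly_measurable_def)
    qed
  qed simp
qed

text \<open>
  The simple functions are \<open>u\<close> sampled at grid points; the samples are taken at
  \<open>\<tau> n t = max a (\<lfloor>(n + 1) t\<rfloor> / (n + 1))\<close>, which stays in \<open>[a, b]\<close>.
\<close>

lemma L2_continuous_on_imp_strongly_measurable:
  assumes u: "L2_continuous_on {a..b} S u"
  shows "L2_strongly_measurable a b S u"
proof -
  define \<tau> where "\<tau> n t = max a (of_int \<lfloor>real (Suc n) * t\<rfloor> / real (Suc n))" for n :: nat and t :: real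
  have \<tau>_le: "\<tau> n t \<in> {a..b}" "\<bar>\<tau> n t - t\<bar> \<le> 1 / real (Suc n)" if "t \<in> {a..b}" for n t
  proof -
    have "of_int \<lfloor>real (Suc n) * t\<rfloor> / real (Suc n) \<le> t" "t \<le> of_int \<lfloor>real (Suc n) * t\<rfloor> / real (Suc n) + 1 / real (Suc n)"
      using of_int_floor_le[of "real (Suc n) * t"] real_of_int_floor_add_one_ge[of "real (Suc n) * t"]
      by (simp_all add: field_simps del: of_nat_Suc)
    then show "\<tau> n t \<in> {a..b}" "\<bar>\<tau> n t - t\<bar> \<le> 1 / real (Suc n)"
      using that by (auto simp: \<tau>_def)
  qed
  have \<tau>_simple: "simple_function (lebesgue_on {a..b}) (\<tau> n)" for n
  proof (rule simple_function_borel_measurable)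
    have "\<tau> n \<in> borel_measurable borel" unfolding \<tau>_def by measurable
    then show "\<tau> n \<in> borel_measurable (lebesgue_on {a..b})"
      by (intro measurable_restrict_space1 measurable_completion) simp
    have "\<tau> n ` {a..b} \<subseteq> (\<lambda>k. max a (of_int k / real (Suc n))) ` {\<lfloor>real (Suc n) * a\<rfloor>..\<lfloor>real (Suc n) * b\<rfloor>}"
      by (auto simp: \<tau>_def intro!: imageI floor_mono mult_left_mono)
    then show "finite (\<tau> n ` space (lebesgue_on {a..b}))"
      by (simp add: finite_subset)
  qed
  show ?thesis
    unfolding L2_strongly_measurable_def
  proof (intro conjI exI[of _ "\<lambda>n t. u (\<tau> n t)"] allI ballI)
    show "simple_function (lebesgue_on {a..b}) (\<lambda>t. u (\<tau> n t))" for n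
      by (rule simple_function_compose1[OF \<tau>_simple])
    show "u t \<in> L2_space S" if "t \<in> {a..b}" for t
      using u that by (simp add: L2_continuous_on_def)
    show "u (\<tau> n t) \<in> L2_space S" if "t \<in> {a..b}" for n t
      using u \<tau>_le(1)[OF that] by (simp add: L2_continuous_on_def)
    show "AE t in lebesgue_on {a..b}. (\<lambda>n. norm_L2 S (\<lambda>x. u (\<tau> n t) x - u t x)) \<longlonglongrightarrow> 0"
    proof (rule AE_I2)
      fix t assume "t \<in> space (lebesgue_on {a..b})"
      then have t: "t \<in> {a..b}" by simp
      have "(\<lambda>n. \<tau> n t - t) \<longlonglongrightarrow> 0"
        by (rule Lim_null_comparison[OF always_eventually LIMSEQ_inverse_real_of_nat])
          (use \<tau>_le(2)[OF t] in \<open>auto simp: divide_inverse\<close>)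
      then have lim: "(\<lambda>n. \<tau> n t) \<longlonglongrightarrow> t" by (rule LIM_zero_cancel)
      have "((\<lambda>s. norm_L2 S (\<lambda>x. u s x - u t x)) \<longlongrightarrow> norm_L2 S (\<lambda>x. u t x - u t x)) (at t within {a..b})"
        using u t by (simp add: L2_continuous_on_def norm_L2_def)
      then have "continuous (at t within {a..b}) (\<lambda>s. norm_L2 S (\<lambda>x. u s x - u t x))"
        by (simp add: continuous_within)
      then have "((\<lambda>s. norm_L2 S (\<lambda>x. u s x - u t x)) \<circ> (\<lambda>n. \<tau> n t)) \<longlonglongrightarrow> norm_L2 S (\<lambda>x. u t x - u t x)"
        using lim \<tau>_le(1)[OF t] by (auto simp: continuous_within_sequentially)
      then show "(\<lambda>n. norm_L2 S (\<lambda>x. u (\<tau> n t) x - u t x)) \<longlonglongrightarrow> 0"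
        by (simp add: comp_def norm_L2_def)
    qed
  qed
qed

lemma L2_continuous_on_norm_bounded:
  assumes u: "L2_continuous_on I S u" and I: "compact I"
  shows "\<exists>K\<ge>0. \<forall>t\<in>I. norm_L2 S (u t) \<le> K"
proof -
  have "continuous_on I (\<lambda>t. norm_L2 S (u t))"
    unfolding continuous_on_def
  proof
    fix t assume t: "t \<in> I"
    have "((\<lambda>s. norm_L2 S (u s) - norm_L2 S (u t)) \<longlongrightarrow> 0) (at t within I)"
    proof (rule Lim_null_comparison)
      show "\<forall>\<^sub>F s in at t within I. norm (norm_L2 S (u s) - norm_L2 S (u t)) \<le> norm_L2 S (\<lambda>x. u s x - u t x)"
        using u t unfolding eventually_at_filter
        by (intro always_eventually) (auto simp: L2_continuous_on_def intro!: norm_L2_diff_bound)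
    qed (use u t in \<open>auto simp: L2_continuous_on_def\<close>)
    then show "((\<lambda>s. norm_L2 S (u s)) \<longlongrightarrow> norm_L2 S (u t)) (at t within I)"
      by (rule LIM_zero_cancel)
  qed
  then have "bounded ((\<lambda>t. norm_L2 S (u t)) ` I)"
    using I by (intro compact_imp_bounded compact_continuous_image)
  then obtain K where "K > 0" "\<forall>t\<in>I. norm (norm_L2 S (u t)) \<le> K"
    by (auto simp: bounded_pos)
  then show ?thesis by (intro exI[of _ K]) auto
qed

lemma L2_continuous_on_imp_Linf_L2:
  assumes u: "L2_continuous_on {a..b} S u"
  shows "u \<in> Linf_L2 a b S"
proof -
  obtain K where "\<forall>t\<in>{a..b}. norm_L2 S (u t) \<le> K"
    using L2_continuous_on_norm_bounded[OF u] by auto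
  then have "AE t in lebesgue_on {a..b}. norm_L2 S (u t) \<le> K" by (intro AE_I2) auto
  then show ?thesis
    using L2_continuous_on_imp_strongly_measurable[OF u] by (auto simp: Linf_L2_def)
qed

text \<open>
  Weak convergence in \<open>L\<^sup>2(S)\<close> at each time, together with a uniform norm bound, implies weak*
  convergence in \<open>L\<^sup>\<infinity>([a,b]; L\<^sup>2(S))\<close>, by dominated convergence in time.
\<close>

lemma weakstar_Linf_L2_pointwise:
  fixes U :: "real \<Rightarrow> real \<Rightarrow> 'a::euclidean_space \<Rightarrow> real"
  assumes U: "\<And>e. e > 0 \<Longrightarrow> L2_continuous_on {a..b} S (U e)" and u: "L2_continuous_on {a..b} S u"
    and bd: "\<forall>\<^sub>F e in at_right 0. \<forall>t\<in>{a..b}. norm_L2 S (U e t) \<le> K"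
    and lim: "\<And>t \<phi>. t \<in> {a..b} \<Longrightarrow> \<phi> \<in> L2_space S \<Longrightarrow>
      ((\<lambda>e. LINT x|lebesgue_on S. U e t x * \<phi> x) \<longlongrightarrow> (LINT x|lebesgue_on S. u t x * \<phi> x)) (at_right 0)"
  shows "weakstar_Linf_L2 a b S U u (at_right 0)"
  unfolding weakstar_Linf_L2_def
proof (intro conjI ballI)
  show "\<forall>\<^sub>F e in at_right 0. U e \<in> Linf_L2 a b S"
    using U unfolding eventually_at_filter
    by (intro always_eventually) (auto intro: L2_continuous_on_imp_Linf_L2)
  show "u \<in> Linf_L2 a b S" by (rule L2_continuous_on_imp_Linf_L2[OF u])
  fix \<phi> assume "\<phi> \<in> L1_L2 a b S"
  then have \<phi>: "L2_strongly_measurable a b S \<phi>" "integrable (lebesgue_on {a..b}) (\<lambda>t. norm_L2 S (\<phi> t))"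
    by (auto simp: L1_L2_def)
  have \<phi>L2: "\<phi> t \<in> L2_space S" if "t \<in> {a..b}" for t
    using \<phi>(1) that by (simp add: L2_strongly_measurable_def)
  obtain d where d: "d > 0" "\<And>e t. 0 < e \<Longrightarrow> e < d \<Longrightarrow> t \<in> {a..b} \<Longrightarrow> norm_L2 S (U e t) \<le> K"
    using bd by (auto simp: eventually_at_right_field)
  have "((\<lambda>e. LINT t|lebesgue_on {a..b}. LINT x|lebesgue_on S. U e t x * \<phi> t x) \<longlongrightarrow>
        (LINT t|lebesgue_on {a..b}. LINT x|lebesgue_on S. u t x * \<phi> t x)) (at 0 within {0<..<d})"
  proof (rule tendsto_integral_dominated_within[where h="\<lambda>t. K * norm_L2 S (\<phi> t)"])
    show "(\<lambda>t. LINT x|lebesgue_on S. U e t x * \<phi> t x) \<in> borel_measurable (lebesgue_on {a..b})"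
      if "e \<in> {0<..<d}" for e
      using that by (intro L2_strongly_measurable_inner L2_continuous_on_imp_strongly_measurable U \<phi>(1)) auto
    show "(\<lambda>t. LINT x|lebesgue_on S. u t x * \<phi> t x) \<in> borel_measurable (lebesgue_on {a..b})"
      by (intro L2_strongly_measurable_inner L2_continuous_on_imp_strongly_measurable u \<phi>(1))
    show "integrable (lebesgue_on {a..b}) (\<lambda>t. K * norm_L2 S (\<phi> t))" using \<phi>(2) by simp
    show "AE t in lebesgue_on {a..b}. \<bar>LINT x|lebesgue_on S. U e t x * \<phi> t x\<bar> \<le> K * norm_L2 S (\<phi> t)"
      if e: "e \<in> {0<..<d}" for e
    proof (rule AE_I2)
      fix t assume "t \<in> space (lebesgue_on {a..b})"
      then have t: "t \<in> {a..b}" by simp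
      have "U e t \<in> L2_space S" using U[of e] e t by (simp add: L2_continuous_on_def)
      from L2_Cauchy_Schwarz[OF this \<phi>L2[OF t]]
      show "\<bar>LINT x|lebesgue_on S. U e t x * \<phi> t x\<bar> \<le> K * norm_L2 S (\<phi> t)"
        by (rule order_trans) (use d e t in \<open>auto intro!: mult_right_mono\<close>)
    qed
    show "AE t in lebesgue_on {a..b}. ((\<lambda>e. LINT x|lebesgue_on S. U e t x * \<phi> t x) \<longlongrightarrow> (LINT x|lebesgue_on S. u t x * \<phi> t x)) (at 0 within {0<..<d})"
      using lim \<phi>L2 by (intro AE_I2) (auto intro!: tendsto_within_subset[where S="{0<..}" and T="{0<..<d}"])
  qed
  moreover have "at 0 within {0<..<d} = at_right 0"
    using d by (intro at_within_nhd[where S="{..<d}"]) auto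
  ultimately show "((\<lambda>e. LINT t|lebesgue_on {a..b}. LINT x|lebesgue_on S. U e t x * \<phi> t x) \<longlongrightarrow>
        (LINT t|lebesgue_on {a..b}. LINT x|lebesgue_on S. u t x * \<phi> t x)) (at_right 0)" by simp
qed

section \<open>Averaging operators and the limit evolution\<close>

text \<open>
  Kernels bounded by \<open>B\<close> for which \<open>x \<mapsto> k x y\<close> is continuous at each \<open>x\<close>, for almost every \<open>y\<close>. The exceptional
  null set accommodates the indicator of a ball, which jumps on the sphere.
\<close>

definition averaging_kernel :: "'a::euclidean_space set \<Rightarrow> real \<Rightarrow> ('a \<Rightarrow> 'a \<Rightarrow> real) \<Rightarrow> bool" where
  "averaging_kernel S B k \<longleftrightarrow>
     (\<forall>x. k x \<in> borel_measurable (lebesgue_on S)) \<and> (\<forall>x y. \<bar>k x y\<bar> \<le> B) \<and>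
     (\<forall>x. AE y in lebesgue_on S. isCont (\<lambda>x. k x y) x)"

text \<open>
  The integral operator with kernel \<open>k\<close> over \<open>S\<close>.
\<close>

definition kernel_integral :: "'a::euclidean_space set \<Rightarrow> ('a \<Rightarrow> 'a \<Rightarrow> real) \<Rightarrow> ('a \<Rightarrow> real) \<Rightarrow> 'a \<Rightarrow> real" where
  "kernel_integral S k w x = (LINT y|lebesgue_on S. k x y * w y)"

lemma averaging_kernel_integrable:
  assumes k: "averaging_kernel S B k" and w: "integrable (lebesgue_on S) w"
  shows "integrable (lebesgue_on S) (\<lambda>y. k x y * w y)"
proof (rule Bochner_Integration.integrable_bound)
  show "integrable (lebesgue_on S) (\<lambda>y. B * w y)" using w by simp
  have "k x \<in> borel_measurable (lebesgue_on S)" using k by (simp add: averaging_kernel_def)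
  then show "(\<lambda>y. k x y * w y) \<in> borel_measurable (lebesgue_on S)" using w by measurable
  have "\<bar>k x y\<bar> \<le> \<bar>B\<bar>" for y
    using k unfolding averaging_kernel_def by (meson abs_ge_self order_trans)
  then show "AE y in lebesgue_on S. norm (k x y * w y) \<le> norm (B * w y)"
    by (auto simp: abs_mult intro!: mult_right_mono)
qed

lemma kernel_integral_diff_le:
  assumes k: "averaging_kernel S B k" and w: "integrable (lebesgue_on S) w" and v: "integrable (lebesgue_on S) v"
  shows "\<bar>kernel_integral S k w x - kernel_integral S k v x\<bar> \<le> B * (LINT y|lebesgue_on S. \<bar>w y - v y\<bar>)"
proof -
  note int = averaging_kernel_integrable[OF k]
  have "kernel_integral S k w x - kernel_integral S k v x = (LINT y|lebesgue_on S. k x y * (w y - v y))"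
    using int[OF w] int[OF v] by (simp add: kernel_integral_def right_diff_distrib)
  also have "\<bar>\<dots>\<bar> \<le> (LINT y|lebesgue_on S. B * \<bar>w y - v y\<bar>)"
  proof (rule order_trans[OF integral_abs_bound], rule integral_mono_AE)
    show "integrable (lebesgue_on S) (\<lambda>y. \<bar>k x y * (w y - v y)\<bar>)"
      using int[OF Bochner_Integration.integrable_diff[OF w v]] by simp
    show "AE y in lebesgue_on S. \<bar>k x y * (w y - v y)\<bar> \<le> B * \<bar>w y - v y\<bar>"
      using k by (intro AE_I2) (auto simp: abs_mult averaging_kernel_def intro!: mult_right_mono)
  qed (use w v in simp)
  finally show ?thesis by simp
qed

lemma kernel_integral_le:
  assumes k: "averaging_kernel S B k" and w: "integrable (lebesgue_on S) w"
  shows "\<bar>kernel_integral S k w x\<bar> \<le> B * (LINT y|lebesgue_on S. \<bar>w y\<bar>)"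
  using kernel_integral_diff_le[OF k w, of "\<lambda>_. 0" x] by (simp add: kernel_integral_def)

lemma kernel_integral_continuous:
  assumes k: "averaging_kernel S B k" and w: "integrable (lebesgue_on S) w"
  shows "continuous_on UNIV (kernel_integral S k w)"
  unfolding kernel_integral_def
proof (rule continuous_on_integral_dominated)
  show "integrable (lebesgue_on S) (\<lambda>y. B * \<bar>w y\<bar>)" using w by simp
  show "(\<lambda>y. k x y * w y) \<in> borel_measurable (lebesgue_on S)" for x
    using averaging_kernel_integrable[OF k w] by auto
  show "AE y in lebesgue_on S. \<bar>k x y * w y\<bar> \<le> B * \<bar>w y\<bar>" for x
    using k by (intro AE_I2) (auto simp: abs_mult averaging_kernel_def intro!: mult_right_mono)
  have "AE y in lebesgue_on S. isCont (\<lambda>x. k x y) x" for x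
    using k by (simp add: averaging_kernel_def)
  then show "AE y in lebesgue_on S. ((\<lambda>x. k x y * w y) \<longlongrightarrow> k x y * w y) (at x)" for x
    by (rule eventually_mono) (auto simp: isCont_def intro: tendsto_intros)
qed

text \<open>
  The function \<open>s * u0 + p\<close> encoded by the pair \<open>(s, p)\<close> of a number and a bounded continuous function. The
  solution \<open>z\<close> of the limit evolution has this form at all times.
\<close>

definition profile :: "('a \<Rightarrow> real) \<Rightarrow> real \<times> ('a::euclidean_space \<Rightarrow>\<^sub>C real) \<Rightarrow> 'a \<Rightarrow> real" where
  "profile u0 v y = fst v * u0 y + apply_bcontfun (snd v) y"

lemma bounded_linear_profile: "bounded_linear (\<lambda>v. profile u0 v y)"
proof -
  have "bounded_linear (\<lambda>f :: 'a \<Rightarrow>\<^sub>C real. apply_bcontfun f y)"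
    by (rule bounded_linear_intro[where K=1]) (use norm_bounded[where 'b=real] in auto)
  then show ?thesis
    unfolding profile_def
    by (intro bounded_linear_add bounded_linear_mult_const bounded_linear_fst
        bounded_linear_compose[OF _ bounded_linear_snd])
qed

lemma profile_diff: "profile u0 (v - w) y = profile u0 v y - profile u0 w y"
  and profile_scale: "profile u0 (c *\<^sub>R v) y = c * profile u0 v y"
  by (auto simp: profile_def algebra_simps)

instance bcontfun :: (metric_space, banach) banach ..

text \<open>
  The data of the problem with two abstract kernels: \<open>k1\<close> for the convolution with \<open>J\<close> and \<open>k2\<close> for the
  local averages. The number \<open>\<kappa>\<close> is a floor for the denominators of the averages.
\<close>

locale nonlocal_reaction =
  fixes \<Omega> :: "'a::euclidean_space set" and k1 k2 :: "'a \<Rightarrow> 'a \<Rightarrow> real" and B :: real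
    and \<X> u0 :: "'a \<Rightarrow> real" and M :: real and g :: "real \<Rightarrow> real" and L \<kappa> :: real
  assumes open_\<Omega>: "open \<Omega>" and bounded_\<Omega>: "bounded \<Omega>"
    and k1: "averaging_kernel \<Omega> B k1" and k2: "averaging_kernel \<Omega> B k2"
    and X_measurable: "\<X> \<in> borel_measurable (lebesgue_on \<Omega>)"
    and X_bounded: "AE y in lebesgue_on \<Omega>. \<bar>\<X> y\<bar> \<le> M" and M: "M \<ge> 1"
    and X_zero: "\<And>x. x \<notin> \<Omega> \<Longrightarrow> \<X> x = 0"
    and u0: "u0 \<in> L2_space \<Omega>"
    and g_Lipschitz: "\<And>r s. \<bar>g r - g s\<bar> \<le> L * \<bar>r - s\<bar>" and L: "L \<ge> 0"
    and \<kappa>: "\<kappa> > 0"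
begin

lemma \<Omega>_measurable [measurable, simp]: "\<Omega> \<in> sets lebesgue"
  using open_\<Omega> by simp

lemma finite_measure_\<Omega>: "finite_measure (lebesgue_on \<Omega>)"
proof
  show "emeasure (lebesgue_on \<Omega>) (space (lebesgue_on \<Omega>)) \<noteq> \<infinity>"
    using emeasure_bounded_finite[OF bounded_\<Omega>] open_\<Omega>
    by (simp add: emeasure_restrict_space)
qed

text \<open>
  The volume of \<open>\<Omega>\<close>.
\<close>

abbreviation vol :: real where "vol \<equiv> measure (lebesgue_on \<Omega>) (space (lebesgue_on \<Omega>))"

lemma B_nonneg: "B \<ge> 0"
  using k1 unfolding averaging_kernel_def by (meson abs_ge_zero order_trans)

text \<open>
  The operator \<open>w \<mapsto> A\<^sub>1 w + g (A\<^sub>2 w / A\<^sub>2 \<rho>)\<close>. Cutting the denominator off at \<open>\<kappa>\<close> makes it defined and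
  Lipschitz on the whole space; on the sets that matter \<open>A\<^sub>2 \<rho> \<ge> \<kappa>\<close> and the cut-off is inactive.
\<close>

definition reaction :: "('a \<Rightarrow> real) \<Rightarrow> ('a \<Rightarrow> real) \<Rightarrow> 'a \<Rightarrow> real" where
  "reaction \<rho> w x =
     kernel_integral \<Omega> k1 w x + g (kernel_integral \<Omega> k2 w x / max \<kappa> (kernel_integral \<Omega> k2 \<rho> x))"

text \<open>
  A Lipschitz constant of the reaction from \<open>L\<^sup>1(\<Omega>)\<close> to the supremum norm, independent of the weight.
\<close>

definition reaction_Lipschitz :: real where "reaction_Lipschitz = B + L * (B / \<kappa>)"

lemma reaction_Lipschitz_nonneg: "reaction_Lipschitz \<ge> 0"
  using B_nonneg L \<kappa> by (simp add: reaction_Lipschitz_def)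

lemma reaction_diff_le:
  assumes "integrable (lebesgue_on \<Omega>) w" "integrable (lebesgue_on \<Omega>) v"
  shows "\<bar>reaction \<rho> w x - reaction \<rho> v x\<bar> \<le> reaction_Lipschitz * (LINT y|lebesgue_on \<Omega>. \<bar>w y - v y\<bar>)"
proof -
  define D where "D = (LINT y|lebesgue_on \<Omega>. \<bar>w y - v y\<bar>)"
  define N where "N = max \<kappa> (kernel_integral \<Omega> k2 \<rho> x)"
  have N: "N \<ge> \<kappa>" "N > 0" using \<kappa> by (auto simp: N_def)
  have D0: "D \<ge> 0" by (simp add: D_def integral_nonneg_AE)
  have "\<bar>g (kernel_integral \<Omega> k2 w x / N) - g (kernel_integral \<Omega> k2 v x / N)\<bar>
      \<le> L * \<bar>kernel_integral \<Omega> k2 w x / N - kernel_integral \<Omega> k2 v x / N\<bar>"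
    by (rule g_Lipschitz)
  also have "\<dots> = L * (\<bar>kernel_integral \<Omega> k2 w x - kernel_integral \<Omega> k2 v x\<bar> / N)"
    using N by (simp add: diff_divide_distrib[symmetric])
  also have "\<dots> \<le> L * (B * D / \<kappa>)"
    using kernel_integral_diff_le[OF k2 assms, of x] N \<kappa> L B_nonneg D0
    by (intro mult_left_mono frac_le) (auto simp: D_def)
  finally show ?thesis
    using kernel_integral_diff_le[OF k1 assms, of x]
    by (simp add: reaction_def reaction_Lipschitz_def N_def D_def algebra_simps abs_le_iff)
qed

lemma reaction_in_bcontfun:
  assumes w: "integrable (lebesgue_on \<Omega>) w" and \<rho>: "integrable (lebesgue_on \<Omega>) \<rho>"
  shows "reaction \<rho> w \<in> bcontfun"
proof (rule bcontfun_normI)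
  have gc: "continuous_on UNIV g"
    using g_Lipschitz L by (intro lipschitz_on_continuous_on[of L]) (auto simp: lipschitz_on_def dist_real_def)
  show "continuous_on UNIV (reaction \<rho> w)"
    unfolding reaction_def[abs_def] using \<kappa>
    by (intro continuous_intros continuous_on_compose2[OF gc] kernel_integral_continuous[OF k1 w]
        kernel_integral_continuous[OF k2 w] kernel_integral_continuous[OF k2 \<rho>]) auto
  fix x
  have "reaction \<rho> (\<lambda>_. 0) x = g 0" by (simp add: reaction_def kernel_integral_def)
  then show "norm (reaction \<rho> w x) \<le> \<bar>g 0\<bar> + reaction_Lipschitz * (LINT y|lebesgue_on \<Omega>. \<bar>w y\<bar>)"
    using reaction_diff_le[OF w, of "\<lambda>_. 0" \<rho> x] by simp
qed

lemma profile_L2: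
  shows "profile u0 v \<in> L2_space \<Omega>"
    and "norm_L2 \<Omega> (profile u0 v) \<le> (norm_L2 \<Omega> u0 + sqrt vol) * norm v"
proof -
  interpret finite_measure "lebesgue_on \<Omega>" by (rule finite_measure_\<Omega>)
  have meas: "(\<lambda>y. apply_bcontfun (snd v) y) \<in> borel_measurable (lebesgue_on \<Omega>)"
    by (intro continuous_imp_measurable_on_sets_lebesgue) auto
  have bd: "\<bar>apply_bcontfun (snd v) y\<bar> \<le> norm v" for y
    using norm_bounded[of "snd v" y] norm_snd_le[of "snd v" "fst v"] by simp
  have const: "(\<lambda>y. norm v) \<in> L2_space \<Omega>"
    by (rule L2_bounded[OF finite_measure_\<Omega>, where B="norm v"]) auto
  note p = norm_L2_abs_le[OF meas const AE_I2]
  have pL2: "(\<lambda>y. apply_bcontfun (snd v) y) \<in> L2_space \<Omega>" by (rule p(1)) (use bd in simp)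
  have pn: "norm_L2 \<Omega> (\<lambda>y. apply_bcontfun (snd v) y) \<le> norm_L2 \<Omega> (\<lambda>y. norm v)"
    by (rule p(2)) (use bd in simp)
  note s = L2_scale[OF u0, of "fst v"]
  show "profile u0 v \<in> L2_space \<Omega>"
    unfolding profile_def[abs_def] by (rule L2_add[OF s(1) pL2])
  have "norm_L2 \<Omega> (profile u0 v) \<le> \<bar>fst v\<bar> * norm_L2 \<Omega> u0 + norm_L2 \<Omega> (\<lambda>y. norm v)"
    unfolding profile_def[abs_def] using L2_add(2)[OF s(1) pL2] s(2) pn by linarith
  also have "norm_L2 \<Omega> (\<lambda>y. norm v) = sqrt vol * norm v"
    by (simp add: norm_L2_def real_sqrt_mult mult.commute)
  also have "\<bar>fst v\<bar> * norm_L2 \<Omega> u0 \<le> norm v * norm_L2 \<Omega> u0"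
    using norm_fst_le[of "fst v" "snd v"] by (intro mult_right_mono) auto
  finally show "norm_L2 \<Omega> (profile u0 v) \<le> (norm_L2 \<Omega> u0 + sqrt vol) * norm v"
    by (simp add: algebra_simps)
qed

lemma weighted_L2:
  assumes \<rho>: "\<rho> \<in> borel_measurable (lebesgue_on \<Omega>)" "AE y in lebesgue_on \<Omega>. \<bar>\<rho> y\<bar> \<le> M"
    and f: "f \<in> L2_space \<Omega>"
  shows "(\<lambda>y. \<rho> y * f y) \<in> L2_space \<Omega>" "norm_L2 \<Omega> (\<lambda>y. \<rho> y * f y) \<le> M * norm_L2 \<Omega> f"
proof -
  have "(\<lambda>y. \<rho> y * f y) \<in> borel_measurable (lebesgue_on \<Omega>)"
    using \<rho>(1) L2_space_measurable[OF f] by measurable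
  moreover have "AE y in lebesgue_on \<Omega>. \<bar>\<rho> y * f y\<bar> \<le> \<bar>M * f y\<bar>"
    using \<rho>(2) by eventually_elim (use M in \<open>auto simp: abs_mult intro!: mult_right_mono\<close>)
  ultimately show "(\<lambda>y. \<rho> y * f y) \<in> L2_space \<Omega>" "norm_L2 \<Omega> (\<lambda>y. \<rho> y * f y) \<le> M * norm_L2 \<Omega> f"
    using norm_L2_abs_le[OF _ L2_scale(1)[OF f, of M]] L2_scale(2)[OF f, of M] M by auto
qed

lemma L1_le_L2:
  assumes f: "f \<in> L2_space \<Omega>"
  shows "(LINT y|lebesgue_on \<Omega>. \<bar>f y\<bar>) \<le> sqrt vol * norm_L2 \<Omega> f"
proof (rule power2_le_imp_le)
  show "(LINT y|lebesgue_on \<Omega>. \<bar>f y\<bar>)\<^sup>2 \<le> (sqrt vol * norm_L2 \<Omega> f)\<^sup>2"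
    using L2_imp_L1(2)[OF finite_measure_\<Omega> f] by (simp add: power_mult_distrib norm_L2_squared)
qed simp

lemma X_integrable: "integrable (lebesgue_on \<Omega>) \<X>"
proof -
  interpret finite_measure "lebesgue_on \<Omega>" by (rule finite_measure_\<Omega>)
  show ?thesis using X_bounded X_measurable by (intro integrable_const_bound) auto
qed

text \<open>
  The right-hand side of the limit evolution in the coordinates \<open>(s, p)\<close>: \<open>s' = - s\<close> and
  \<open>p' = F (\<X> z) - p\<close>, which is \<open>z' = F (\<X> z) - z\<close> for the profile \<open>z = s * u0 + p\<close>.
\<close>

definition vector_field :: "real \<times> ('a \<Rightarrow>\<^sub>C real) \<Rightarrow> real \<times> ('a \<Rightarrow>\<^sub>C real)" where
  "vector_field v = (0, Bcontfun (reaction \<X> (\<lambda>y. \<X> y * profile u0 v y))) - v"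

lemma X_profile_integrable: "integrable (lebesgue_on \<Omega>) (\<lambda>y. \<X> y * profile u0 v y)"
  by (intro L2_imp_L1(1)[OF finite_measure_\<Omega>] weighted_L2 X_measurable X_bounded profile_L2)

lemma profile_vector_field:
  "profile u0 (vector_field v) x = reaction \<X> (\<lambda>y. \<X> y * profile u0 v y) x - profile u0 v x"
proof -
  have "profile u0 (0, f) x = apply_bcontfun f x" for f by (simp add: profile_def)
  then show ?thesis
    unfolding vector_field_def profile_diff
    by (simp add: Bcontfun_inverse reaction_in_bcontfun X_integrable X_profile_integrable)
qed

lemma vector_field_Lipschitz: "\<exists>C. C-lipschitz_on UNIV vector_field"
proof -
  define K where "K = reaction_Lipschitz * (sqrt vol * (M * (norm_L2 \<Omega> u0 + sqrt vol)))"
  have K: "K \<ge> 0"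
    unfolding K_def using reaction_Lipschitz_nonneg M
    by (intro mult_nonneg_nonneg add_nonneg_nonneg) auto
  have "norm (vector_field v - vector_field w) \<le> (K + 1) * norm (v - w)" for v w
  proof -
    let ?r = "\<lambda>v. Bcontfun (reaction \<X> (\<lambda>y. \<X> y * profile u0 v y))"
    have r: "apply_bcontfun (?r v) = reaction \<X> (\<lambda>y. \<X> y * profile u0 v y)" for v
      by (simp add: Bcontfun_inverse reaction_in_bcontfun X_integrable X_profile_integrable)
    have "dist (?r v) (?r w) \<le> K * norm (v - w)"
    proof (rule dist_bound)
      fix x
      have "dist (apply_bcontfun (?r v) x) (apply_bcontfun (?r w) x)
          \<le> reaction_Lipschitz * (LINT y|lebesgue_on \<Omega>. \<bar>\<X> y * profile u0 v y - \<X> y * profile u0 w y\<bar>)"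
        unfolding r dist_real_def by (intro reaction_diff_le X_profile_integrable)
      also have "(LINT y|lebesgue_on \<Omega>. \<bar>\<X> y * profile u0 v y - \<X> y * profile u0 w y\<bar>)
          = (LINT y|lebesgue_on \<Omega>. \<bar>\<X> y * profile u0 (v - w) y\<bar>)"
        by (simp add: profile_diff right_diff_distrib)
      also have "\<dots> \<le> sqrt vol * norm_L2 \<Omega> (\<lambda>y. \<X> y * profile u0 (v - w) y)"
        by (intro L1_le_L2 weighted_L2 X_measurable X_bounded profile_L2)
      also have "\<dots> \<le> sqrt vol * (M * ((norm_L2 \<Omega> u0 + sqrt vol) * norm (v - w)))"
        using profile_L2(2)[of "v - w"] M
        by (intro mult_left_mono order_trans[OF weighted_L2(2)[OF X_measurable X_bounded profile_L2(1)]]) auto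
      finally show "dist (apply_bcontfun (?r v) x) (apply_bcontfun (?r w) x) \<le> K * norm (v - w)"
        using reaction_Lipschitz_nonneg by (simp add: K_def mult_left_mono mult.assoc)
    qed
    moreover have "vector_field v - vector_field w = (0, ?r v - ?r w) - (v - w)"
      by (simp add: vector_field_def algebra_simps)
    then have "norm (vector_field v - vector_field w) \<le> norm (0 :: real, ?r v - ?r w) + norm (v - w)"
      by (simp only: norm_triangle_ineq4)
    moreover have "norm (0 :: real, ?r v - ?r w) = dist (?r v) (?r w)"
      by (simp add: norm_Pair dist_norm)
    ultimately show ?thesis
      unfolding distrib_right by linarith
  qed
  then have "(K + 1)-lipschitz_on UNIV vector_field"
    using K by (auto simp: lipschitz_on_def dist_norm)
  then show ?thesis by blast
qed

text \<open>
  The initial value \<open>(1, 0)\<close> has the profile \<open>u0\<close>.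
\<close>

lemma limit_evolution_exists:
  obtains \<zeta> where "\<zeta> 0 = (1, 0)" "\<And>t. (\<zeta> has_vector_derivative vector_field (\<zeta> t)) (at t)"
proof -
  obtain C where "C-lipschitz_on UNIV vector_field" using vector_field_Lipschitz by blast
  from global_Lipschitz_ode_solution[OF this, of "(1, 0)"] that show thesis by blast
qed

lemma continuous_vector_field: "continuous_on UNIV vector_field"
  using vector_field_Lipschitz lipschitz_on_continuous_on by blast

lemma X_profile_L2_UNIV:
  "(\<lambda>y. \<X> y * profile u0 v y) \<in> L2_space UNIV"
  "norm_L2 UNIV (\<lambda>y. \<X> y * profile u0 v y) \<le> (M * (norm_L2 \<Omega> u0 + sqrt vol)) * norm v"
proof -
  note w = weighted_L2[OF X_measurable X_bounded profile_L2(1)[of v]]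
  note s = L2_superset[OF \<Omega>_measurable, of UNIV "\<lambda>y. \<X> y * profile u0 v y"]
  show "(\<lambda>y. \<X> y * profile u0 v y) \<in> L2_space UNIV" using s(1) w(1) X_zero by simp
  have "norm_L2 UNIV (\<lambda>y. \<X> y * profile u0 v y) \<le> M * norm_L2 \<Omega> (profile u0 v)"
    using s(2) w(2) X_zero by simp
  also have "\<dots> \<le> M * ((norm_L2 \<Omega> u0 + sqrt vol) * norm v)"
    using M by (intro mult_left_mono profile_L2) auto
  finally show "norm_L2 UNIV (\<lambda>y. \<X> y * profile u0 v y) \<le> (M * (norm_L2 \<Omega> u0 + sqrt vol)) * norm v"
    by (simp add: mult.assoc)
qed

text \<open>
  If \<open>\<zeta>\<close> follows the vector field, then \<open>\<X> z\<close> is a \<open>C\<^sup>1\<close> curve in \<open>L\<^sup>2\<close> of the whole space.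
\<close>

lemma limit_C1:
  assumes \<zeta>: "\<And>t. (\<zeta> has_vector_derivative vector_field (\<zeta> t)) (at t)"
  shows "L2_C1_deriv_on I UNIV (\<lambda>t x. \<X> x * profile u0 (\<zeta> t) x) (\<lambda>t x. \<X> x * profile u0 (vector_field (\<zeta> t)) x)"
proof (rule L2_C1_deriv_on_bounded_linear_image[OF _ _ X_profile_L2_UNIV \<zeta>])
  have "continuous_on UNIV \<zeta>"
    using \<zeta> by (meson continuous_at_imp_continuous_on has_vector_derivative_continuous)
  then show "continuous_on UNIV (\<lambda>t. vector_field (\<zeta> t))"
    by (intro continuous_on_compose2[OF continuous_vector_field]) auto
qed (auto simp: profile_diff profile_scale algebra_simps)

section \<open>Uniform convergence of the reaction term\<close>

lemma uniform_limit_kernel_integral: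
  fixes \<psi> :: "'e \<Rightarrow> 'a \<Rightarrow> real" and \<zeta> :: "real \<Rightarrow> real \<times> ('a \<Rightarrow>\<^sub>C real)"
  assumes k: "averaging_kernel \<Omega> B k" and I: "compact I" "compact K" and \<zeta>: "continuous_on UNIV \<zeta>"
    and \<psi>: "\<forall>\<^sub>F e in F. \<psi> e \<in> borel_measurable (lebesgue_on \<Omega>) \<and> (AE y in lebesgue_on \<Omega>. \<bar>\<psi> e y\<bar> \<le> M)"
    and weak: "\<And>\<phi>. integrable (lebesgue_on \<Omega>) \<phi> \<Longrightarrow>
       ((\<lambda>e. LINT y|lebesgue_on \<Omega>. \<psi> e y * \<phi> y) \<longlongrightarrow> (LINT y|lebesgue_on \<Omega>. \<X> y * \<phi> y)) F"
  shows "uniform_limit (I \<times> K) (\<lambda>e (t, x). kernel_integral \<Omega> k (\<lambda>y. \<psi> e y * profile u0 (\<zeta> t) y) x)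
     (\<lambda>(t, x). kernel_integral \<Omega> k (\<lambda>y. \<X> y * profile u0 (\<zeta> t) y) x) F"
proof -
  interpret finite_measure "lebesgue_on \<Omega>" by (rule finite_measure_\<Omega>)
  have "bounded (\<zeta> ` I)"
    using \<zeta> I(1) by (intro compact_imp_bounded compact_continuous_image) (auto intro: continuous_on_subset)
  then obtain R where R: "R > 0" "\<And>t. t \<in> I \<Longrightarrow> norm (\<zeta> t) \<le> R"
    by (auto simp: bounded_pos)
  have profile_le: "\<bar>profile u0 (\<zeta> t) y\<bar> \<le> R * (\<bar>u0 y\<bar> + 1)" if "t \<in> I" for t y
  proof -
    have "\<bar>fst (\<zeta> t)\<bar> \<le> R" "\<bar>apply_bcontfun (snd (\<zeta> t)) y\<bar> \<le> R"
      using R(2)[OF that] norm_fst_le[of "fst (\<zeta> t)" "snd (\<zeta> t)"] norm_bounded[of "snd (\<zeta> t)" y]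
        norm_snd_le[of "snd (\<zeta> t)" "fst (\<zeta> t)"] by simp_all
    then have "\<bar>fst (\<zeta> t) * u0 y\<bar> \<le> R * \<bar>u0 y\<bar>"
      by (simp add: abs_mult mult_right_mono)
    with \<open>\<bar>apply_bcontfun (snd (\<zeta> t)) y\<bar> \<le> R\<close> show ?thesis
      by (simp add: profile_def algebra_simps)
  qed
  have "uniform_limit (I \<times> K) (\<lambda>e i. LINT y|lebesgue_on \<Omega>. \<psi> e y * (k (snd i) y * profile u0 (\<zeta> (fst i)) y))
     (\<lambda>i. LINT y|lebesgue_on \<Omega>. \<X> y * (k (snd i) y * profile u0 (\<zeta> (fst i)) y)) F"
  proof (rule uniform_limit_weak_convergence[where C=M and h="\<lambda>y. B * (R * (\<bar>u0 y\<bar> + 1))"])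
    show "compact (I \<times> K)" using I by (rule compact_Times)
    show "(\<lambda>y. k (snd i) y * profile u0 (\<zeta> (fst i)) y) \<in> borel_measurable (lebesgue_on \<Omega>)" for i
      using averaging_kernel_integrable[OF k L2_imp_L1(1)[OF finite_measure_\<Omega> profile_L2(1)]] by auto
    show "integrable (lebesgue_on \<Omega>) (\<lambda>y. B * (R * (\<bar>u0 y\<bar> + 1)))"
      using L2_imp_L1(1)[OF finite_measure_\<Omega> u0] by simp
    show "AE y in lebesgue_on \<Omega>. \<bar>k (snd i) y * profile u0 (\<zeta> (fst i)) y\<bar> \<le> B * (R * (\<bar>u0 y\<bar> + 1))"
      if "i \<in> I \<times> K" for i
      using k profile_le that B_nonneg unfolding abs_mult
      by (intro AE_I2 mult_mono) (auto simp: averaging_kernel_def)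
    show "AE y in lebesgue_on \<Omega>. ((\<lambda>j. k (snd j) y * profile u0 (\<zeta> (fst j)) y) \<longlongrightarrow> k (snd i) y * profile u0 (\<zeta> (fst i)) y) (at i within I \<times> K)"
      for i
    proof -
      have "AE y in lebesgue_on \<Omega>. isCont (\<lambda>x. k x y) (snd i)"
        using k by (simp add: averaging_kernel_def)
      then show ?thesis
      proof eventually_elim
        case (elim y)
        have "isCont (\<lambda>j. k (snd j) y) i"
          by (rule isCont_o2[where f=snd and g="\<lambda>x. k x y"]) (use elim in simp_all)
        moreover have "isCont (\<lambda>j. profile u0 (\<zeta> (fst j)) y) i"
        proof (rule isCont_o2[where f=fst and g="\<lambda>t. profile u0 (\<zeta> t) y"])
          have "isCont \<zeta> (fst i)" using \<zeta> by (simp add: continuous_on_eq_continuous_at)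
          then show "isCont (\<lambda>t. profile u0 (\<zeta> t) y) (fst i)"
            by (rule bounded_linear.isCont[OF bounded_linear_profile])
        qed simp
        ultimately have "isCont (\<lambda>j. k (snd j) y * profile u0 (\<zeta> (fst j)) y) i"
          by (rule isCont_mult)
        then show ?case by (auto simp: isCont_def intro: tendsto_within_subset)
      qed
    qed
  qed (use \<psi> X_measurable X_bounded M weak in auto)
  then show ?thesis
    by (simp add: kernel_integral_def case_prod_beta' mult.left_commute)
qed

lemma uniform_limit_reaction:
  fixes \<psi> :: "'e \<Rightarrow> 'a \<Rightarrow> real" and \<zeta> :: "real \<Rightarrow> real \<times> ('a \<Rightarrow>\<^sub>C real)"
  assumes I: "compact I" "compact K" and \<zeta>: "continuous_on UNIV \<zeta>"
    and \<psi>: "\<forall>\<^sub>F e in F. \<psi> e \<in> borel_measurable (lebesgue_on \<Omega>) \<and> (AE y in lebesgue_on \<Omega>. \<bar>\<psi> e y\<bar> \<le> M)"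
    and weak: "\<And>\<phi>. integrable (lebesgue_on \<Omega>) \<phi> \<Longrightarrow>
       ((\<lambda>e. LINT y|lebesgue_on \<Omega>. \<psi> e y * \<phi> y) \<longlongrightarrow> (LINT y|lebesgue_on \<Omega>. \<X> y * \<phi> y)) F"
  shows "uniform_limit (I \<times> K) (\<lambda>e (t, x). reaction (\<psi> e) (\<lambda>y. \<psi> e y * profile u0 (\<zeta> t) y) x)
     (\<lambda>(t, x). reaction \<X> (\<lambda>y. \<X> y * profile u0 (\<zeta> t) y) x) F"
proof -
  note lim = uniform_limit_kernel_integral[OF _ I _ \<psi> weak]
  \<comment> \<open>The constant curve at \<open>(0, 1)\<close> has profile 1, so the denominators are a special case.\<close>
  have "uniform_limit (I \<times> K) (\<lambda>e (t, x). kernel_integral \<Omega> k2 (\<psi> e) x) (\<lambda>(t, x). kernel_integral \<Omega> k2 \<X> x) F"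
    using lim[OF k2, of "\<lambda>_. (0, const_bcontfun 1)"] by (simp add: profile_def const_bcontfun.rep_eq)
  moreover have "uniformly_continuous_on UNIV (max \<kappa>)"
    by (intro lipschitz_on_uniformly_continuous[of 1]) (auto simp: lipschitz_on_def dist_real_def)
  ultimately have den: "uniform_limit (I \<times> K) (\<lambda>e (t, x). max \<kappa> (kernel_integral \<Omega> k2 (\<psi> e) x))
     (\<lambda>(t, x). max \<kappa> (kernel_integral \<Omega> k2 \<X> x)) F"
    using uniform_limit_compose_uniformly_continuous_on[where B=UNIV and f="max \<kappa>" and A="I \<times> K" and F=F]
    by (fastforce simp: case_prod_beta')
  have num: "uniform_limit (I \<times> K) (\<lambda>e (t, x). kernel_integral \<Omega> k2 (\<lambda>y. \<psi> e y * profile u0 (\<zeta> t) y) x)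
     (\<lambda>(t, x). kernel_integral \<Omega> k2 (\<lambda>y. \<X> y * profile u0 (\<zeta> t) y) x) F"
    by (rule lim[OF k2 \<zeta>])
  have bdd: "bounded ((\<lambda>(t, x). kernel_integral \<Omega> k2 (\<lambda>y. \<X> y * profile u0 (\<zeta> t) y) x) ` (I \<times> K))"
  proof -
    have "bounded (\<zeta> ` I)"
      using \<zeta> I(1) by (intro compact_imp_bounded compact_continuous_image) (auto intro: continuous_on_subset)
    then obtain R where R: "R > 0" "\<And>t. t \<in> I \<Longrightarrow> norm (\<zeta> t) \<le> R"
      by (auto simp: bounded_pos)
    have "\<bar>kernel_integral \<Omega> k2 (\<lambda>y. \<X> y * profile u0 (\<zeta> t) y) x\<bar> \<le> B * (sqrt vol * (M * ((norm_L2 \<Omega> u0 + sqrt vol) * R)))"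
      if "t \<in> I" for t x
    proof -
      have "norm_L2 \<Omega> (\<lambda>y. \<X> y * profile u0 (\<zeta> t) y) \<le> M * ((norm_L2 \<Omega> u0 + sqrt vol) * R)"
        using profile_L2(2)[of "\<zeta> t"] R(2)[OF that] M
        by (intro order_trans[OF weighted_L2(2)[OF X_measurable X_bounded profile_L2(1)]]
            mult_left_mono order_trans[OF profile_L2(2)]) auto
      then have "(LINT y|lebesgue_on \<Omega>. \<bar>\<X> y * profile u0 (\<zeta> t) y\<bar>) \<le> sqrt vol * (M * ((norm_L2 \<Omega> u0 + sqrt vol) * R))"
        by (intro order_trans[OF L1_le_L2[OF weighted_L2(1)[OF X_measurable X_bounded profile_L2(1)]]] mult_left_mono) auto
      then show ?thesis
        using B_nonneg by (intro order_trans[OF kernel_integral_le[OF k2 X_profile_integrable]] mult_left_mono)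
    qed
    then show ?thesis by (auto simp: bounded_real)
  qed
  have "uniform_limit (I \<times> K)
     (\<lambda>e i. (case i of (t, x) \<Rightarrow> kernel_integral \<Omega> k2 (\<lambda>y. \<psi> e y * profile u0 (\<zeta> t) y) x) / (case i of (t, x) \<Rightarrow> max \<kappa> (kernel_integral \<Omega> k2 (\<psi> e) x)))
     (\<lambda>i. (case i of (t, x) \<Rightarrow> kernel_integral \<Omega> k2 (\<lambda>y. \<X> y * profile u0 (\<zeta> t) y) x) / (case i of (t, x) \<Rightarrow> max \<kappa> (kernel_integral \<Omega> k2 \<X> x))) F"
    using \<kappa> by (intro uniform_lim_divide[OF num den bdd, of \<kappa>]) auto
  moreover have "uniformly_continuous_on UNIV g"
    using g_Lipschitz L by (intro lipschitz_on_uniformly_continuous[of L]) (auto simp: lipschitz_on_def dist_real_def)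
  ultimately have gl: "uniform_limit (I \<times> K)
     (\<lambda>e i. g ((case i of (t, x) \<Rightarrow> kernel_integral \<Omega> k2 (\<lambda>y. \<psi> e y * profile u0 (\<zeta> t) y) x) / (case i of (t, x) \<Rightarrow> max \<kappa> (kernel_integral \<Omega> k2 (\<psi> e) x))))
     (\<lambda>i. g ((case i of (t, x) \<Rightarrow> kernel_integral \<Omega> k2 (\<lambda>y. \<X> y * profile u0 (\<zeta> t) y) x) / (case i of (t, x) \<Rightarrow> max \<kappa> (kernel_integral \<Omega> k2 \<X> x)))) F"
    by (rule uniform_limit_compose_uniformly_continuous_on[where B=UNIV]) auto
  show ?thesis
    using uniform_limit_add[OF lim[OF k1 \<zeta>] gl] by (simp add: reaction_def case_prod_beta')
qed

section \<open>Comparison of the perforated solutions with the limit evolution\<close>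

text \<open>
  The constant \<open>C\<close> in the differential inequality \<open>\<bar>E'\<bar> \<le> C E + r\<^sup>2\<close> for the energy.
\<close>

definition energy_rate :: real where
  "energy_rate = 2 + (2 * reaction_Lipschitz + 1) * vol"

lemma energy_rate_pos: "energy_rate > 0"
proof -
  have "(2 * reaction_Lipschitz + 1) * vol \<ge> 0"
    using reaction_Lipschitz_nonneg by (intro mult_nonneg_nonneg) auto
  then show ?thesis by (simp add: energy_rate_def)
qed

text \<open>
  The distance between a perforated solution and \<open>1\<^sub>P z\<close> is controlled by the error \<open>r\<close> of replacing
  the weight \<open>1\<^sub>P\<close> by \<open>\<X>\<close> in the reaction term along the limit evolution.
\<close>

lemma energy_estimate:
  fixes u u' :: "real \<Rightarrow> 'a \<Rightarrow> real"
  assumes \<zeta>0: "\<zeta> 0 = (1, 0)" and \<zeta>: "\<And>t. (\<zeta> has_vector_derivative vector_field (\<zeta> t)) (at t)"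
    and P: "open P" "P \<subseteq> \<Omega>" and zero: "\<And>t x. x \<notin> P \<Longrightarrow> u t x = 0"
    and init: "AE x in lebesgue_on P. u 0 x = u0 x"
    and C1: "\<And>a b. a < b \<Longrightarrow> L2_C1_deriv_on {a..b} P u u'"
    and eq: "\<And>t. AE x in lebesgue_on P. u' t x = reaction (indicator P) (u t) x - u t x"
    and r: "\<And>t x. \<bar>t\<bar> \<le> T \<Longrightarrow> x \<in> P \<Longrightarrow>
       \<bar>reaction (indicator P) (\<lambda>y. indicator P y * profile u0 (\<zeta> t) y) x - reaction \<X> (\<lambda>y. \<X> y * profile u0 (\<zeta> t) y) x\<bar> \<le> r"
    and t: "\<bar>t\<bar> \<le> T" and r0: "r \<ge> 0"
  shows "norm_L2 \<Omega> (\<lambda>x. u t x - indicator P x * profile u0 (\<zeta> t) x) \<le> r * sqrt (exp (energy_rate * T) / energy_rate)"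
proof -
  have P_meas: "P \<in> sets lebesgue" using P(1) by simp
  note sub = P_meas \<Omega>_measurable P(2)
  have finP: "finite_measure (lebesgue_on P)"
  proof
    have "bounded P" using bounded_\<Omega> P(2) bounded_subset by blast
    then show "emeasure (lebesgue_on P) (space (lebesgue_on P)) \<noteq> \<infinity>"
      using emeasure_bounded_finite[of P] P(1) by (simp add: emeasure_restrict_space)
  qed
  define z where "z t = profile u0 (\<zeta> t)" for t
  \<comment> \<open>The difference is taken with \<open>z\<close> itself, which agrees with \<open>1\<^sub>P z\<close> on \<open>P\<close> and is \<open>C\<^sup>1\<close> there.\<close>
  define w where "w t x = u t x - z t x" for t x
  define w' where "w' t x = u' t x - profile u0 (vector_field (\<zeta> t)) x" for t x
  have L2P: "profile u0 v \<in> L2_space P" "norm_L2 P (profile u0 v) \<le> (norm_L2 \<Omega> u0 + sqrt vol) * norm v" for v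
    using L2_subset[OF sub profile_L2(1)[of v]] profile_L2(2)[of v] by auto
  have "continuous_on UNIV \<zeta>"
    using \<zeta> by (meson continuous_at_imp_continuous_on has_vector_derivative_continuous)
  then have cont: "continuous_on UNIV (\<lambda>t. vector_field (\<zeta> t))"
    by (intro continuous_on_compose2[OF continuous_vector_field]) auto
  have "L2_C1_deriv_on J P (\<lambda>t. profile u0 (\<zeta> t)) (\<lambda>t. profile u0 (vector_field (\<zeta> t)))" for J
    by (rule L2_C1_deriv_on_bounded_linear_image[OF profile_diff profile_scale L2P \<zeta> cont])
  then have wC1: "L2_C1_deriv_on {a..b} P w w'" if "a < b" for a b
    unfolding w_def[abs_def] w'_def[abs_def] z_def using C1[OF that] L2_C1_deriv_on_diff by blast
  have wL2: "w s \<in> L2_space P" "w' s \<in> L2_space P" for s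
    using wC1[of s "s + 1"] by (auto simp: L2_C1_deriv_on_def L2_continuous_on_def)
  define E where "E t = (LINT x|lebesgue_on P. (w t x)\<^sup>2)" for t
  have derE: "(E has_real_derivative 2 * (LINT x|lebesgue_on P. w s x * w' s x)) (at s)" for s
  proof -
    have "(E has_real_derivative 2 * (LINT x|lebesgue_on P. w s x * w' s x)) (at s within {s-1..s+1})"
      unfolding E_def by (rule L2_energy_has_derivative[OF wC1]) auto
    moreover have "at s within {s-1..s+1} = at s"
      by (rule at_within_interior) (simp add: interior_atLeastAtMost_real)
    ultimately show ?thesis by simp
  qed
  have bound: "\<bar>2 * (LINT x|lebesgue_on P. w s x * w' s x)\<bar> \<le> energy_rate * E s + r\<^sup>2" if s: "\<bar>s\<bar> \<le> T" for s
  proof -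
    define N where "N = (LINT x|lebesgue_on P. \<bar>w s x\<bar>)"
    have N0: "N \<ge> 0" by (simp add: N_def integral_nonneg_AE)
    have w1: "integrable (lebesgue_on P) (w s)" using L2_imp_L1(1)[OF finP wL2(1)] .
    define \<chi>z where "\<chi>z = (\<lambda>y. indicator P y * z s y)"
    have "integrable (lebesgue_on P) (u s)" "integrable (lebesgue_on P) \<chi>z"
    proof -
      have z: "integrable (lebesgue_on P) (z s)"
        unfolding z_def by (rule L2_imp_L1(1)[OF finP L2P(1)])
      with w1 have "integrable (lebesgue_on P) (\<lambda>x. w s x + z s x)" by simp
      then show "integrable (lebesgue_on P) (u s)" by (simp add: w_def)
      show "integrable (lebesgue_on P) \<chi>z"
        using z by (subst Bochner_Integration.integrable_cong[where g="z s"]) (auto simp: \<chi>z_def)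
    qed
    then have int: "integrable (lebesgue_on \<Omega>) (u s)" "integrable (lebesgue_on \<Omega>) \<chi>z"
      using integral_lebesgue_on_superset(1)[OF sub] zero by (auto simp: \<chi>z_def)
    have L1: "(LINT y|lebesgue_on \<Omega>. \<bar>u s y - \<chi>z y\<bar>) = N"
    proof -
      have "(LINT y|lebesgue_on \<Omega>. \<bar>u s y - \<chi>z y\<bar>) = (LINT y|lebesgue_on P. \<bar>u s y - \<chi>z y\<bar>)"
        by (rule integral_lebesgue_on_superset(2)[OF sub]) (simp add: zero \<chi>z_def)
      also have "\<dots> = N" unfolding N_def
        by (intro Bochner_Integration.integral_cong) (auto simp: \<chi>z_def w_def)
      finally show ?thesis .
    qed
    have "AE x in lebesgue_on P. \<bar>w s x * w' s x\<bar> \<le> (w s x)\<^sup>2 + (reaction_Lipschitz * N + r) * \<bar>w s x\<bar>"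
    proof -
      have "AE x in lebesgue_on P. x \<in> P" by (rule AE_I2) simp
      with eq[of s] show ?thesis
      proof eventually_elim
        case (elim x)
        \<comment> \<open>The first bracket is Lipschitz in \<open>w\<close>, the second is the error \<open>r\<close>.\<close>
        have "w' s x = - w s x + (reaction (indicator P) (u s) x - reaction (indicator P) \<chi>z x)
           + (reaction (indicator P) \<chi>z x - reaction \<X> (\<lambda>y. \<X> y * z s y) x)"
          using elim by (simp add: w'_def w_def z_def profile_vector_field)
        moreover have "\<bar>reaction (indicator P) (u s) x - reaction (indicator P) \<chi>z x\<bar> \<le> reaction_Lipschitz * N"
          using reaction_diff_le[OF int] unfolding L1 .
        moreover have "\<bar>reaction (indicator P) \<chi>z x - reaction \<X> (\<lambda>y. \<X> y * z s y) x\<bar> \<le> r"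
          using r[OF s] elim unfolding \<chi>z_def z_def by simp
        ultimately have "\<bar>w' s x\<bar> \<le> \<bar>w s x\<bar> + (reaction_Lipschitz * N + r)" by linarith
        then have "\<bar>w s x\<bar> * \<bar>w' s x\<bar> \<le> \<bar>w s x\<bar> * (\<bar>w s x\<bar> + (reaction_Lipschitz * N + r))"
          by (rule mult_left_mono) simp
        then show ?case by (simp add: abs_mult power2_eq_square algebra_simps)
      qed
    qed
    then have "\<bar>LINT x|lebesgue_on P. w s x * w' s x\<bar> \<le> (LINT x|lebesgue_on P. (w s x)\<^sup>2 + (reaction_Lipschitz * N + r) * \<bar>w s x\<bar>)"
      using L2_mult_integrable[OF wL2] L2_space_square_integrable[OF wL2(1)] w1
      by (intro order_trans[OF integral_abs_bound] integral_mono_AE) auto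
    also have "\<dots> = E s + (reaction_Lipschitz * N + r) * N"
      using L2_space_square_integrable[OF wL2(1)] w1 by (simp add: E_def N_def)
    finally have "\<bar>2 * (LINT x|lebesgue_on P. w s x * w' s x)\<bar> \<le> 2 * E s + 2 * reaction_Lipschitz * N\<^sup>2 + 2 * r * N"
      by (simp add: power2_eq_square algebra_simps)
    also have "\<dots> \<le> 2 * E s + (2 * reaction_Lipschitz + 1) * N\<^sup>2 + r\<^sup>2"
      using sum_squares_bound[of r N] by (simp add: algebra_simps)
    also have "(2 * reaction_Lipschitz + 1) * N\<^sup>2 \<le> (2 * reaction_Lipschitz + 1) * (vol * E s)"
    proof -
      have "N\<^sup>2 \<le> measure (lebesgue_on P) (space (lebesgue_on P)) * E s"
        unfolding N_def E_def by (rule L2_imp_L1(2)[OF finP wL2(1)])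
      also have "measure (lebesgue_on P) (space (lebesgue_on P)) \<le> vol"
      proof -
        have "measure lebesgue P \<le> measure lebesgue \<Omega>"
          using P(2) P_meas by (rule measure_mono_fmeasurable[OF _ _ lmeasurable_open[OF bounded_\<Omega> open_\<Omega>]])
        then show ?thesis using P_meas by (simp add: measure_restrict_space)
      qed
      finally have "N\<^sup>2 \<le> vol * E s" by (simp add: E_def mult_right_mono integral_nonneg_AE)
      then show ?thesis using reaction_Lipschitz_nonneg by (intro mult_left_mono) auto
    qed
    finally show ?thesis by (simp add: energy_rate_def algebra_simps)
  qed
  have "E 0 = (LINT x|lebesgue_on P. 0)"
    unfolding E_def
  proof (rule integral_cong_AE)
    show "AE x in lebesgue_on P. (w 0 x)\<^sup>2 = 0"
      using init by eventually_elim (simp add: w_def z_def profile_def \<zeta>0)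
  qed (use L2_space_measurable[OF wL2(1)] in auto)
  then have E0: "E 0 = 0" by simp
  have "E t \<le> r\<^sup>2 / energy_rate * exp (energy_rate * T)"
    by (rule Gronwall_two_sided[OF derE bound E0 energy_rate_pos t])
  also have "\<dots> = (r * sqrt (exp (energy_rate * T) / energy_rate))\<^sup>2"
    using energy_rate_pos by (simp add: power_mult_distrib)
  finally have "sqrt (E t) \<le> \<bar>r * sqrt (exp (energy_rate * T) / energy_rate)\<bar>"
    using real_sqrt_le_mono by fastforce
  moreover have "norm_L2 \<Omega> (\<lambda>x. u t x - indicator P x * profile u0 (\<zeta> t) x) = norm_L2 P (\<lambda>x. u t x - indicator P x * profile u0 (\<zeta> t) x)"
    by (rule L2_superset(2)[OF sub]) (simp add: zero)
  moreover have "\<dots> = sqrt (E t)"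
    unfolding norm_L2_def E_def
    by (intro arg_cong[where f=sqrt] Bochner_Integration.integral_cong) (auto simp: w_def z_def)
  ultimately show ?thesis using r0 energy_rate_pos by (simp add: abs_mult)
qed

lemma perforated_solution_near_profile:
  fixes u u' :: "real \<Rightarrow> real \<Rightarrow> 'a \<Rightarrow> real"
  assumes \<zeta>0: "\<zeta> 0 = (1, 0)" and \<zeta>: "\<And>t. (\<zeta> has_vector_derivative vector_field (\<zeta> t)) (at t)"
    and P: "\<And>\<epsilon>. \<epsilon> > 0 \<Longrightarrow> open (P \<epsilon>)" "\<And>\<epsilon>. \<epsilon> > 0 \<Longrightarrow> P \<epsilon> \<subseteq> \<Omega>"
    and weak: "\<And>\<phi>. integrable (lebesgue_on \<Omega>) \<phi> \<Longrightarrow>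
       ((\<lambda>\<epsilon>. LINT y|lebesgue_on \<Omega>. indicator (P \<epsilon>) y * \<phi> y) \<longlongrightarrow> (LINT y|lebesgue_on \<Omega>. \<X> y * \<phi> y)) (at_right 0)"
    and zero: "\<And>\<epsilon> t x. \<epsilon> > 0 \<Longrightarrow> x \<notin> P \<epsilon> \<Longrightarrow> u \<epsilon> t x = 0"
    and init: "\<And>\<epsilon>. \<epsilon> > 0 \<Longrightarrow> AE x in lebesgue_on (P \<epsilon>). u \<epsilon> 0 x = u0 x"
    and C1: "\<And>\<epsilon> a b. \<epsilon> > 0 \<Longrightarrow> a < b \<Longrightarrow> L2_C1_deriv_on {a..b} (P \<epsilon>) (u \<epsilon>) (u' \<epsilon>)"
    and eq: "\<forall>\<^sub>F \<epsilon> in at_right 0. \<forall>t. AE x in lebesgue_on (P \<epsilon>).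
       u' \<epsilon> t x = reaction (indicator (P \<epsilon>)) (u \<epsilon> t) x - u \<epsilon> t x"
    and \<eta>: "\<eta> > 0"
  shows "\<forall>\<^sub>F \<epsilon> in at_right 0. \<forall>t. \<bar>t\<bar> \<le> T \<longrightarrow>
     norm_L2 \<Omega> (\<lambda>x. u \<epsilon> t x - indicator (P \<epsilon>) x * profile u0 (\<zeta> t) x) \<le> \<eta>"
proof -
  define Q where "Q = sqrt (exp (energy_rate * T) / energy_rate)"
  have Q: "Q > 0" unfolding Q_def using energy_rate_pos by simp
  define r where "r = \<eta> / Q"
  have r: "r > 0" "r * Q = \<eta>" using \<eta> Q by (auto simp: r_def)
  have pos: "\<forall>\<^sub>F \<epsilon> in at_right (0::real). \<epsilon> > 0" by (rule eventually_at_right_less)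
  have \<zeta>_cont: "continuous_on UNIV \<zeta>"
    using \<zeta> by (meson continuous_at_imp_continuous_on has_vector_derivative_continuous)
  have ind: "\<forall>\<^sub>F \<epsilon> in at_right 0. (indicator (P \<epsilon>) :: 'a \<Rightarrow> real) \<in> borel_measurable (lebesgue_on \<Omega>) \<and>
      (AE y in lebesgue_on \<Omega>. \<bar>indicator (P \<epsilon>) y :: real\<bar> \<le> M)"
    using pos
  proof eventually_elim
    case (elim \<epsilon>)
    then show ?case
      using P[of \<epsilon>] M by (auto simp: sets_restrict_space_iff indicator_def intro!: borel_measurable_indicator)
  qed
  have "uniform_limit ({-T..T} \<times> closure \<Omega>)
     (\<lambda>\<epsilon> (t, x). reaction (indicator (P \<epsilon>)) (\<lambda>y. indicator (P \<epsilon>) y * profile u0 (\<zeta> t) y) x)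
     (\<lambda>(t, x). reaction \<X> (\<lambda>y. \<X> y * profile u0 (\<zeta> t) y) x) (at_right 0)"
    using bounded_\<Omega> by (intro uniform_limit_reaction \<zeta>_cont ind weak) auto
  from uniform_limitD[OF this r(1)] pos eq show ?thesis
  proof eventually_elim
    case (elim \<epsilon>)
    show ?case
    proof (intro allI impI)
      fix t assume t: "\<bar>t\<bar> \<le> T"
      have "norm_L2 \<Omega> (\<lambda>x. u \<epsilon> t x - indicator (P \<epsilon>) x * profile u0 (\<zeta> t) x) \<le> r * Q"
        unfolding Q_def
      proof (rule energy_estimate[OF \<zeta>0 \<zeta>, where u'="u' \<epsilon>"])
        show "\<bar>reaction (indicator (P \<epsilon>)) (\<lambda>y. indicator (P \<epsilon>) y * profile u0 (\<zeta> s) y) x -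
            reaction \<X> (\<lambda>y. \<X> y * profile u0 (\<zeta> s) y) x\<bar> \<le> r"
          if "\<bar>s\<bar> \<le> T" "x \<in> P \<epsilon>" for s x
        proof -
          have "(s, x) \<in> {-T..T} \<times> closure \<Omega>"
            using that P(2)[OF elim(2)] closure_subset by (auto simp: abs_le_iff)
          from elim(1)[rule_format, OF this] show ?thesis by (simp add: dist_real_def)
        qed
      qed (use elim P zero init C1 t r in auto)
      then show "norm_L2 \<Omega> (\<lambda>x. u \<epsilon> t x - indicator (P \<epsilon>) x * profile u0 (\<zeta> t) x) \<le> \<eta>"
        using r by simp
    qed
  qed
qed

text \<open>
  The equation is assumed for small \<open>\<epsilon>\<close> only: the cut-off at \<open>\<kappa>\<close> in the reaction is inactive once the
  denominators of the averages over the perforated set exceed \<open>\<kappa>\<close>.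
\<close>

lemma perforated_solution_weakstar:
  fixes u u' :: "real \<Rightarrow> real \<Rightarrow> 'a \<Rightarrow> real"
  assumes \<zeta>0: "\<zeta> 0 = (1, 0)" and \<zeta>: "\<And>t. (\<zeta> has_vector_derivative vector_field (\<zeta> t)) (at t)"
    and P: "\<And>\<epsilon>. \<epsilon> > 0 \<Longrightarrow> open (P \<epsilon>)" "\<And>\<epsilon>. \<epsilon> > 0 \<Longrightarrow> P \<epsilon> \<subseteq> \<Omega>"
    and weak: "\<And>\<phi>. integrable (lebesgue_on \<Omega>) \<phi> \<Longrightarrow>
       ((\<lambda>\<epsilon>. LINT y|lebesgue_on \<Omega>. indicator (P \<epsilon>) y * \<phi> y) \<longlongrightarrow> (LINT y|lebesgue_on \<Omega>. \<X> y * \<phi> y)) (at_right 0)"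
    and zero: "\<And>\<epsilon> t x. \<epsilon> > 0 \<Longrightarrow> x \<notin> P \<epsilon> \<Longrightarrow> u \<epsilon> t x = 0"
    and init: "\<And>\<epsilon>. \<epsilon> > 0 \<Longrightarrow> AE x in lebesgue_on (P \<epsilon>). u \<epsilon> 0 x = u0 x"
    and C1: "\<And>\<epsilon> a b. \<epsilon> > 0 \<Longrightarrow> a < b \<Longrightarrow> L2_C1_deriv_on {a..b} (P \<epsilon>) (u \<epsilon>) (u' \<epsilon>)"
    and eq: "\<forall>\<^sub>F \<epsilon> in at_right 0. \<forall>t. AE x in lebesgue_on (P \<epsilon>).
       u' \<epsilon> t x = reaction (indicator (P \<epsilon>)) (u \<epsilon> t) x - u \<epsilon> t x"
    and ab: "a < b"
  shows "weakstar_Linf_L2 a b \<Omega> u (\<lambda>t x. \<X> x * profile u0 (\<zeta> t) x) (at_right 0)"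
proof -
  define T where "T = max \<bar>a\<bar> \<bar>b\<bar>"
  have T: "\<bar>t\<bar> \<le> T" if "t \<in> {a..b}" for t using that by (auto simp: T_def)
  define v where "v \<epsilon> t x = u \<epsilon> t x - indicator (P \<epsilon>) x * profile u0 (\<zeta> t) x" for \<epsilon> t x
  have near: "\<forall>\<^sub>F \<epsilon> in at_right 0. \<forall>t. \<bar>t\<bar> \<le> T \<longrightarrow> norm_L2 \<Omega> (v \<epsilon> t) \<le> \<eta>" if "\<eta> > 0" for \<eta>
    unfolding v_def using perforated_solution_near_profile[OF \<zeta>0 \<zeta> P weak zero init C1 eq that] .
  have pos: "\<forall>\<^sub>F \<epsilon> in at_right (0::real). \<epsilon> > 0" by (rule eventually_at_right_less)
  have cont_u: "L2_continuous_on {c..d} \<Omega> (u \<epsilon>)" if "\<epsilon> > 0" "c < d" for \<epsilon> c d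
  proof -
    have P': "P \<epsilon> \<in> sets lebesgue" "P \<epsilon> \<subseteq> \<Omega>" using P that by auto
    have "L2_continuous_on {c..d} (P \<epsilon>) (u \<epsilon>)"
      using C1[OF that] by (simp add: L2_C1_deriv_on_def)
    then show ?thesis
      using L2_continuous_on_superset[OF P'(1) \<Omega>_measurable P'(2), of "u \<epsilon>"] zero[OF that(1)] by simp
  qed
  have uL2: "u \<epsilon> t \<in> L2_space \<Omega>" if "\<epsilon> > 0" for \<epsilon> t
    using cont_u[OF that, of t "t + 1"] by (auto simp: L2_continuous_on_def)
  have ind: "(\<lambda>x. indicator (P \<epsilon>) x * f x) \<in> L2_space \<Omega>"
    "norm_L2 \<Omega> (\<lambda>x. indicator (P \<epsilon>) x * f x) \<le> M * norm_L2 \<Omega> f"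
    if "\<epsilon> > 0" "f \<in> L2_space \<Omega>" for \<epsilon> and f :: "'a \<Rightarrow> real"
  proof -
    have "(indicator (P \<epsilon>) :: 'a \<Rightarrow> real) \<in> borel_measurable (lebesgue_on \<Omega>)"
      using P that by (auto simp: sets_restrict_space_iff intro!: borel_measurable_indicator)
    moreover have "AE y in lebesgue_on \<Omega>. \<bar>indicator (P \<epsilon>) y :: real\<bar> \<le> M"
      using M by (auto simp: indicator_def)
    ultimately show "(\<lambda>x. indicator (P \<epsilon>) x * f x) \<in> L2_space \<Omega>"
      "norm_L2 \<Omega> (\<lambda>x. indicator (P \<epsilon>) x * f x) \<le> M * norm_L2 \<Omega> f"
      using weighted_L2 that(2) by blast+
  qed
  have vL2: "v \<epsilon> t \<in> L2_space \<Omega>" if "\<epsilon> > 0" for \<epsilon> t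
    unfolding v_def[abs_def] by (intro L2_diff uL2 ind that profile_L2)
  have "continuous_on {a..b} \<zeta>"
    using \<zeta> by (meson continuous_at_imp_continuous_on has_vector_derivative_continuous)
  then have "bounded (\<zeta> ` {a..b})" by (intro compact_imp_bounded compact_continuous_image) auto
  then obtain R where R: "\<And>t. t \<in> {a..b} \<Longrightarrow> norm (\<zeta> t) \<le> R"
    unfolding bounded_iff by blast
  show ?thesis
  proof (rule weakstar_Linf_L2_pointwise)
    show "L2_continuous_on {a..b} \<Omega> (u \<epsilon>)" if "\<epsilon> > 0" for \<epsilon> by (rule cont_u[OF that ab])
    have "L2_continuous_on {a..b} UNIV (\<lambda>t x. \<X> x * profile u0 (\<zeta> t) x)"
      using limit_C1[OF \<zeta>] by (simp add: L2_C1_deriv_on_def)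
    then show "L2_continuous_on {a..b} \<Omega> (\<lambda>t x. \<X> x * profile u0 (\<zeta> t) x)"
      using L2_continuous_on_superset[OF \<Omega>_measurable, of UNIV "\<lambda>t x. \<X> x * profile u0 (\<zeta> t) x"] X_zero
      by simp
    show "\<forall>\<^sub>F \<epsilon> in at_right 0. \<forall>t\<in>{a..b}. norm_L2 \<Omega> (u \<epsilon> t) \<le> 1 + M * ((norm_L2 \<Omega> u0 + sqrt vol) * R)"
      using near[OF zero_less_one] pos
    proof eventually_elim
      case (elim \<epsilon>)
      show ?case
      proof
        fix t assume t: "t \<in> {a..b}"
        have "norm_L2 \<Omega> (u \<epsilon> t) = norm_L2 \<Omega> (\<lambda>x. v \<epsilon> t x + indicator (P \<epsilon>) x * profile u0 (\<zeta> t) x)"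
          by (simp add: v_def)
        also have "\<dots> \<le> norm_L2 \<Omega> (v \<epsilon> t) + norm_L2 \<Omega> (\<lambda>x. indicator (P \<epsilon>) x * profile u0 (\<zeta> t) x)"
          by (intro L2_add vL2 ind elim profile_L2)
        also have "norm_L2 \<Omega> (v \<epsilon> t) \<le> 1" using elim T[OF t] by blast
        also have "norm_L2 \<Omega> (\<lambda>x. indicator (P \<epsilon>) x * profile u0 (\<zeta> t) x) \<le> M * norm_L2 \<Omega> (profile u0 (\<zeta> t))"
          by (intro ind elim profile_L2)
        also have "\<dots> \<le> M * ((norm_L2 \<Omega> u0 + sqrt vol) * norm (\<zeta> t))"
          using M by (intro mult_left_mono profile_L2) auto
        also have "\<dots> \<le> M * ((norm_L2 \<Omega> u0 + sqrt vol) * R)"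
          using M R[OF t] by (intro mult_left_mono) auto
        finally show "norm_L2 \<Omega> (u \<epsilon> t) \<le> 1 + M * ((norm_L2 \<Omega> u0 + sqrt vol) * R)" by simp
      qed
    qed
    fix t and \<phi> :: "'a \<Rightarrow> real"
    assume t: "t \<in> {a..b}" and \<phi>: "\<phi> \<in> L2_space \<Omega>"
    have "((\<lambda>\<epsilon>. LINT x|lebesgue_on \<Omega>. v \<epsilon> t x * \<phi> x) \<longlongrightarrow> 0) (at_right 0)"
    proof (rule Lim_null_comparison)
      show "\<forall>\<^sub>F \<epsilon> in at_right 0. norm (LINT x|lebesgue_on \<Omega>. v \<epsilon> t x * \<phi> x) \<le> norm_L2 \<Omega> (v \<epsilon> t) * norm_L2 \<Omega> \<phi>"
        using pos by eventually_elim (use L2_Cauchy_Schwarz[OF vL2 \<phi>] in simp)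
      have "((\<lambda>\<epsilon>. norm_L2 \<Omega> (v \<epsilon> t)) \<longlongrightarrow> 0) (at_right 0)"
      proof (rule tendstoI)
        fix \<eta> :: real assume "\<eta> > 0"
        then have "\<forall>\<^sub>F \<epsilon> in at_right 0. norm_L2 \<Omega> (v \<epsilon> t) \<le> \<eta> / 2"
          using near[of "\<eta> / 2"] T[OF t] by (auto elim: eventually_mono)
        then show "\<forall>\<^sub>F \<epsilon> in at_right 0. dist (norm_L2 \<Omega> (v \<epsilon> t)) 0 < \<eta>"
          by eventually_elim (use \<open>\<eta> > 0\<close> in simp)
      qed
      then show "((\<lambda>\<epsilon>. norm_L2 \<Omega> (v \<epsilon> t) * norm_L2 \<Omega> \<phi>) \<longlongrightarrow> 0) (at_right 0)"
        by (rule tendsto_mult_left_zero)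
    qed
    from tendsto_add[OF this weak[OF L2_mult_integrable[OF profile_L2(1)[of "\<zeta> t"] \<phi>]]]
    have "((\<lambda>\<epsilon>. (LINT x|lebesgue_on \<Omega>. v \<epsilon> t x * \<phi> x) +
          (LINT x|lebesgue_on \<Omega>. indicator (P \<epsilon>) x * (profile u0 (\<zeta> t) x * \<phi> x))) \<longlongrightarrow>
        (LINT x|lebesgue_on \<Omega>. \<X> x * (profile u0 (\<zeta> t) x * \<phi> x))) (at_right 0)"
      by simp
    moreover have "\<forall>\<^sub>F \<epsilon> in at_right 0. (LINT x|lebesgue_on \<Omega>. v \<epsilon> t x * \<phi> x) +
          (LINT x|lebesgue_on \<Omega>. indicator (P \<epsilon>) x * (profile u0 (\<zeta> t) x * \<phi> x)) = (LINT x|lebesgue_on \<Omega>. u \<epsilon> t x * \<phi> x)"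
      using pos
    proof eventually_elim
      case (elim \<epsilon>)
      have "integrable (lebesgue_on \<Omega>) (\<lambda>x. indicator (P \<epsilon>) x * (profile u0 (\<zeta> t) x * \<phi> x))"
        using L2_mult_integrable[OF ind(1)[OF elim profile_L2(1)] \<phi>] by (simp add: mult.assoc)
      then show ?case
        using L2_mult_integrable[OF vL2[OF elim] \<phi>]
        by (subst Bochner_Integration.integral_add[symmetric])
          (auto simp: v_def algebra_simps intro!: Bochner_Integration.integral_cong)
    qed
    ultimately show "((\<lambda>\<epsilon>. LINT x|lebesgue_on \<Omega>. u \<epsilon> t x * \<phi> x) \<longlongrightarrow>
        (LINT x|lebesgue_on \<Omega>. \<X> x * profile u0 (\<zeta> t) x * \<phi> x)) (at_right 0)"
      by (simp add: mult.assoc Lim_transform_eventually)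
  qed
qed

end

section \<open>The convolution kernel and the ball averages\<close>

lemma averaging_kernel_ball:
  assumes S: "S \<in> sets lebesgue" and "B \<ge> 1"
  shows "averaging_kernel S B (\<lambda>x y. indicator (ball x \<delta>) y)"
  unfolding averaging_kernel_def
proof (intro conjI allI)
  fix x :: 'a
  have "AE y in lebesgue. y \<notin> sphere x \<delta>"
    using negligible_sphere[of x \<delta>] by (intro AE_not_in) (simp add: negligible_iff_null_sets)
  then have "AE y in lebesgue_on S. y \<notin> sphere x \<delta>"
    using S by (simp add: AE_restrict_space_iff) (auto elim: eventually_mono)
  then show "AE y in lebesgue_on S. isCont (\<lambda>x. indicator (ball x \<delta>) y :: real) x"
  proof eventually_elim
    case (elim y)
    have lim: "((\<lambda>x. dist x y) \<longlongrightarrow> dist x y) (at x)" by (intro tendsto_intros)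
    have "\<forall>\<^sub>F x' in at x. (indicator (ball x' \<delta>) y :: real) = indicator (ball x \<delta>) y"
    proof (cases "dist x y < \<delta>")
      case True
      from order_tendstoD(2)[OF lim this] show ?thesis
        by eventually_elim (use True in simp)
    next
      case False
      then have "\<delta> < dist x y" using elim by simp
      from order_tendstoD(1)[OF lim this] show ?thesis
        by eventually_elim (use False in simp)
    qed
    then show ?case unfolding isCont_def by (rule tendsto_eventually)
  qed
next
  show "(\<lambda>y. indicator (ball x \<delta>) y :: real) \<in> borel_measurable (lebesgue_on S)" for x
    by (intro measurable_restrict_space1 borel_measurable_indicator) simp
qed (use assms in \<open>auto simp: indicator_def\<close>)

lemma averaging_kernel_convolution:
  assumes K: "continuous_on UNIV K" and bd: "\<And>x. \<bar>K x\<bar> \<le> B"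
  shows "averaging_kernel S B (\<lambda>x y. K (x - y))"
  unfolding averaging_kernel_def
proof (intro conjI allI AE_I2)
  show "(\<lambda>y. K (x - y)) \<in> borel_measurable (lebesgue_on S)" for x
  proof -
    have "continuous_on UNIV (\<lambda>y. K (x - y))"
      by (intro continuous_on_compose2[OF K] continuous_intros) auto
    then have "(\<lambda>y. K (x - y)) \<in> borel_measurable lebesgue"
      by (intro measurable_completion) (simp add: borel_measurable_continuous_onI)
    then show ?thesis by (rule measurable_restrict_space1)
  qed
  show "isCont (\<lambda>x. K (x - y)) x" for x y
  proof (rule isCont_o2[where f="\<lambda>x. x - y" and g=K])
    show "isCont K (x - y)" using K by (simp add: continuous_on_eq_continuous_at)
  qed simp
qed (rule bd)

text \<open>
  \<open>J\<close> may be unbounded, but only its values on differences of points of \<open>S\<close> matter; composing \<open>J\<close> with the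
  projection onto a box containing these differences makes it bounded.
\<close>

lemma bounded_kernel_extension:
  fixes J :: "'a::euclidean_space \<Rightarrow> real"
  assumes J: "continuous_on UNIV J" and S: "bounded S"
  obtains K B where "continuous_on UNIV K" "\<And>x. \<bar>K x\<bar> \<le> B" "\<And>x y. x \<in> S \<Longrightarrow> y \<in> S \<Longrightarrow> K (x - y) = J (x - y)" "B \<ge> 1"
proof -
  have "bounded ((\<lambda>(x, y). x - y) ` (S \<times> S))" using S S by (rule bounded_minus)
  then obtain a where a: "(\<lambda>(x, y). x - y) ` (S \<times> S) \<subseteq> cbox (-a) a"
    using bounded_subset_cbox_symmetric by blast
  have Ja: "continuous_on (cbox (-a) a) J" using J continuous_on_subset by blast
  have "bounded (J ` cbox (-a) a)"
    using Ja by (intro compact_imp_bounded compact_continuous_image) auto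
  then have "bounded (range (\<lambda>x. J (clamp (-a) a x)))" by (rule clamp_bounded)
  then obtain B where B: "\<And>x. \<bar>J (clamp (-a) a x)\<bar> \<le> B" by (auto simp: bounded_iff)
  show thesis
  proof (rule that[of "\<lambda>x. J (clamp (-a) a x)" "max B 1"])
    show "continuous_on UNIV (\<lambda>x. J (clamp (-a) a x))" by (rule clamp_continuous_on[OF Ja])
    show "J (clamp (-a) a (x - y)) = J (x - y)" if "x \<in> S" "y \<in> S" for x y
    proof -
      have "x - y \<in> cbox (-a) a" using a that by auto
      then show ?thesis by simp
    qed
  qed (use B in \<open>auto intro: max.coboundedI1\<close>)
qed

lemma has_bochner_integral_lebesgue_reflect_translate:
  fixes J :: "'a::euclidean_space \<Rightarrow> real"
  assumes J: "continuous_on UNIV J" and int: "has_bochner_integral lebesgue J s"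
  shows "has_bochner_integral lebesgue (\<lambda>y. J (x - y)) s"
proof -
  have [measurable]: "J \<in> borel_measurable borel" using J by (rule borel_measurable_continuous_onI)
  have Jl: "integrable lborel J" "integral\<^sup>L lborel J = s"
    using int by (simp_all add: has_bochner_integral_iff integrable_completion integral_completion)
  have distr: "distr lborel borel (\<lambda>y. x - y) = (lborel :: 'a measure)"
    using lborel_affine[of "-1" x] by (simp add: density_1)
  have "integrable lborel (\<lambda>y. J (x - y))"
    using Jl(1) by (subst (asm) distr[symmetric]) (simp add: integrable_distr_eq)
  moreover have "integral\<^sup>L lborel (\<lambda>y. J (x - y)) = s"
    using Jl(2) by (subst (asm) distr[symmetric]) (simp add: integral_distr)
  ultimately show ?thesis
    by (simp add: has_bochner_integral_iff integrable_completion integral_completion)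
qed

text \<open>
  The integral of \<open>\<X>\<close> over the part of a ball inside \<open>S\<close> depends continuously on the centre
  of the ball and is positive for every centre in the compact closure of \<open>S\<close>.
\<close>

lemma ball_average_bounded_below:
  fixes \<X> :: "'a::euclidean_space \<Rightarrow> real"
  assumes S: "open S" "bounded S" "S \<noteq> {}" and X: "integrable (lebesgue_on S) \<X>"
    and c: "c > 0" "\<And>x. x \<in> S \<Longrightarrow> \<X> x \<ge> c" and \<delta>: "\<delta> > 0"
  obtains m where "m > 0" "\<And>x. x \<in> closure S \<Longrightarrow> kernel_integral S (\<lambda>x y. indicator (ball x \<delta>) y) \<X> x \<ge> m"
proof -
  let ?A = "kernel_integral S (\<lambda>x y. indicator (ball x \<delta>) y) \<X>"
  have S_meas: "S \<in> sets lebesgue" using S(1) by simp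
  note k = averaging_kernel_ball[OF S_meas order_refl[of 1], of \<delta>]
  have "continuous_on (closure S) ?A"
    using kernel_integral_continuous[OF k X] continuous_on_subset by blast
  moreover have "compact (closure S)" "closure S \<noteq> {}" using S by auto
  ultimately obtain x0 where x0: "x0 \<in> closure S" "\<And>x. x \<in> closure S \<Longrightarrow> ?A x0 \<le> ?A x"
    using continuous_attains_inf by metis
  have "?A x0 > 0"
  proof -
    have op: "open (ball x0 \<delta> \<inter> S)" using S by auto
    obtain y where "y \<in> S" "dist y x0 < \<delta>" using x0(1) \<delta> by (auto simp: closure_approachable)
    then have ne: "ball x0 \<delta> \<inter> S \<noteq> {}" by (auto simp: dist_commute)
    have lm: "ball x0 \<delta> \<inter> S \<in> lmeasurable"
      using op by (intro lmeasurable_open) (auto intro: bounded_subset[OF bounded_ball])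
    have "measure lebesgue (ball x0 \<delta> \<inter> S) > 0"
      using open_not_negligible[OF op ne] negligible_iff_measure0[OF lm] by (simp add: zero_less_measure_iff)
    moreover have "c * measure lebesgue (ball x0 \<delta> \<inter> S) = (LINT y|lebesgue_on S. c * indicator (ball x0 \<delta>) y)"
      using S_meas
      by (simp add: integral_restrict_space indicator_inter_arith[symmetric] Int_commute measure_restrict_space)
    moreover have "\<dots> \<le> ?A x0"
      unfolding kernel_integral_def
    proof (rule integral_mono_AE)
      show "integrable (lebesgue_on S) (\<lambda>y. c * indicator (ball x0 \<delta>) y)"
      proof -
        have "integrable lebesgue (indicator (S \<inter> ball x0 \<delta>) :: 'a \<Rightarrow> real)"
          using lm by (intro integrable_real_indicator) (auto simp: fmeasurable_def Int_commute)
        then show ?thesis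
          using S_meas by (simp add: integrable_restrict_space indicator_inter_arith[symmetric])
      qed
      show "integrable (lebesgue_on S) (\<lambda>y. indicator (ball x0 \<delta>) y * \<X> y)"
        by (rule averaging_kernel_integrable[OF k X])
      show "AE y in lebesgue_on S. c * indicator (ball x0 \<delta>) y \<le> indicator (ball x0 \<delta>) y * \<X> y"
        using c by (intro AE_I2) (auto simp: indicator_def)
    qed
    ultimately show ?thesis using c by (smt (verit) mult_pos_pos)
  qed
  with x0 that show thesis by blast
qed

section \<open>Homogenization of the nonlocal Dirichlet problem\<close>

theorem theorem2p1:
  fixes \<Omega> :: "'a::euclidean_space set"
    and \<Omega>p :: "real \<Rightarrow> 'a set"
    and \<X> J u0 :: "'a \<Rightarrow> real"
    and g :: "real \<Rightarrow> real"
    and \<delta> c :: real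
    and u :: "real \<Rightarrow> real \<Rightarrow> 'a \<Rightarrow> real"
  assumes "open \<Omega>" and "connected \<Omega>" and "\<Omega> \<noteq> {}" and "bounded \<Omega>"
    and "\<And>\<epsilon>. \<epsilon> > 0 \<Longrightarrow> open (\<Omega>p \<epsilon>)"
    and "\<And>\<epsilon>. \<epsilon> > 0 \<Longrightarrow> \<Omega>p \<epsilon> \<subseteq> \<Omega>"
    and "\<X> \<in> borel_measurable lebesgue"
    and "\<exists>M. AE x in lebesgue. \<bar>\<X> x\<bar> \<le> M"
    and "\<And>x. x \<notin> \<Omega> \<Longrightarrow> \<X> x = 0"
    and "\<And>\<phi> :: 'a \<Rightarrow> real. integrable (lebesgue_on \<Omega>) \<phi> \<Longrightarrow>
           ((\<lambda>\<epsilon>. LINT x|lebesgue_on \<Omega>. indicator (\<Omega>p \<epsilon>) x * \<phi> x) \<longlongrightarrow>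
            (LINT x|lebesgue_on \<Omega>. \<X> x * \<phi> x)) (at_right 0)"
    and "c > 0" and "\<And>x. x \<in> \<Omega> \<Longrightarrow> \<X> x \<ge> c"
    and "continuous_on UNIV J"
    and "\<And>x. J x \<ge> 0" and "J 0 > 0" and "\<And>x. J (- x) = J x"
    and "has_bochner_integral lebesgue J 1"
    and "smooth_real g" and "\<exists>L. L-lipschitz_on UNIV g"
    and "\<delta> > 0"
    and "u0 \<in> L2_space \<Omega>"
    and "\<And>\<epsilon>. \<epsilon> > 0 \<Longrightarrow> perforated_solution J g \<delta> (\<lambda>x. 1) \<Omega> (\<Omega>p \<epsilon>) u0 (u \<epsilon>)"
  shows "\<exists>ustar :: real \<Rightarrow> 'a \<Rightarrow> real.
           limit_solution J g \<delta> \<X> \<Omega> u0 ustar \<and>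
           (\<forall>a b. a < b \<longrightarrow> weakstar_Linf_L2 a b \<Omega> u ustar (at_right 0))"
proof -
  note open_\<Omega> = assms(1) and ne_\<Omega> = assms(3) and bdd_\<Omega> = assms(4) and P = assms(5,6)
  note X_meas = assms(7) and X_zero = assms(9) and weak = assms(10) and c = assms(11,12)
  note J_cont = assms(13) and J_int = assms(17) and \<delta> = assms(20) and u0 = assms(21) and sol = assms(22)
  have \<Omega>_meas: "\<Omega> \<in> sets lebesgue" using open_\<Omega> by simp
  obtain M0 where "AE x in lebesgue. \<bar>\<X> x\<bar> \<le> M0" using assms(8) by blast
  then have X_bdd: "AE x in lebesgue_on \<Omega>. \<bar>\<X> x\<bar> \<le> max M0 1"
    using \<Omega>_meas by (simp add: AE_restrict_space_iff) (auto elim: eventually_mono)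
  obtain L where L: "L-lipschitz_on UNIV g" using assms(19) by blast
  obtain K B where K: "continuous_on UNIV K" "\<And>x. \<bar>K x\<bar> \<le> B" and B: "B \<ge> 1"
    and KJ: "\<And>x y. x \<in> \<Omega> \<Longrightarrow> y \<in> \<Omega> \<Longrightarrow> K (x - y) = J (x - y)"
    using bounded_kernel_extension[OF J_cont bdd_\<Omega>] by metis
  define k1 :: "'a \<Rightarrow> 'a \<Rightarrow> real" where "k1 = (\<lambda>x y. K (x - y))"
  define k2 :: "'a \<Rightarrow> 'a \<Rightarrow> real" where "k2 = (\<lambda>x y. indicator (ball x \<delta>) y)"
  have X_int: "integrable (lebesgue_on \<Omega>) \<X>"
  proof -
    have "emeasure (lebesgue_on \<Omega>) (space (lebesgue_on \<Omega>)) \<noteq> \<infinity>"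
      using emeasure_bounded_finite[OF bdd_\<Omega>] open_\<Omega> by (simp add: emeasure_restrict_space)
    then interpret finite_measure "lebesgue_on \<Omega>" by (rule finite_measureI)
    show ?thesis
      using X_bdd measurable_restrict_space1[OF X_meas] by (intro integrable_const_bound) auto
  qed
  obtain m where m: "m > 0" "\<And>x. x \<in> closure \<Omega> \<Longrightarrow> kernel_integral \<Omega> k2 \<X> x \<ge> m"
    unfolding k2_def using ball_average_bounded_below[OF open_\<Omega> bdd_\<Omega> ne_\<Omega> X_int c \<delta>] by metis
  interpret nonlocal_reaction \<Omega> k1 k2 B \<X> u0 "max M0 1" g L "m / 2"
  proof
    show "averaging_kernel \<Omega> B k1" unfolding k1_def by (rule averaging_kernel_convolution[OF K])
    show "averaging_kernel \<Omega> B k2" unfolding k2_def by (rule averaging_kernel_ball[OF \<Omega>_meas B])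
    show "\<X> \<in> borel_measurable (lebesgue_on \<Omega>)" by (rule measurable_restrict_space1[OF X_meas])
    show "\<bar>g r - g s\<bar> \<le> L * \<bar>r - s\<bar>" for r s
      using lipschitz_onD[OF L, of r s] by (simp add: dist_real_def)
    show "L \<ge> 0" using L by (rule lipschitz_on_nonneg)
  qed (use open_\<Omega> bdd_\<Omega> X_bdd X_zero u0 m in auto)
  obtain \<zeta> where \<zeta>0: "\<zeta> 0 = (1, 0)" and \<zeta>: "\<And>t. (\<zeta> has_vector_derivative vector_field (\<zeta> t)) (at t)"
    using limit_evolution_exists by blast
  define ustar where "ustar t x = \<X> x * profile u0 (\<zeta> t) x" for t x

  have set_int: "(LINT y:A|lebesgue. f y) = (LINT y|lebesgue_on \<Omega>. f' y)"
    if "\<And>y. indicator A y * f y = indicator \<Omega> y * f' y" for A and f f' :: "'a \<Rightarrow> real"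
    using that \<Omega>_meas by (simp add: set_lebesgue_integral_def integral_restrict_space)

  have "\<exists>u'. \<forall>\<epsilon>>0. (\<forall>a b. a < b \<longrightarrow> L2_C1_deriv_on {a..b} (\<Omega>p \<epsilon>) (u \<epsilon>) (u' \<epsilon>)) \<and>
           (\<forall>t. AE x in lebesgue_on (\<Omega>p \<epsilon>).
              u' \<epsilon> t x = (LINT y:(UNIV - (\<Omega> - \<Omega>p \<epsilon>))|lebesgue. J (x - y) * u \<epsilon> t y)
                       - 1 * u \<epsilon> t x + g (mean_on \<delta> (\<Omega>p \<epsilon>) x (u \<epsilon> t)))"
    using sol unfolding perforated_solution_def by (intro choice) blast
  then obtain u' where C1: "\<And>\<epsilon> a b. \<epsilon> > 0 \<Longrightarrow> a < b \<Longrightarrow> L2_C1_deriv_on {a..b} (\<Omega>p \<epsilon>) (u \<epsilon>) (u' \<epsilon>)"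
    and u': "\<And>\<epsilon> t. \<epsilon> > 0 \<Longrightarrow> AE x in lebesgue_on (\<Omega>p \<epsilon>).
              u' \<epsilon> t x = (LINT y:(UNIV - (\<Omega> - \<Omega>p \<epsilon>))|lebesgue. J (x - y) * u \<epsilon> t y)
                       - 1 * u \<epsilon> t x + g (mean_on \<delta> (\<Omega>p \<epsilon>) x (u \<epsilon> t))"
    by blast
  have zero: "\<And>\<epsilon> t x. \<epsilon> > 0 \<Longrightarrow> x \<notin> \<Omega>p \<epsilon> \<Longrightarrow> u \<epsilon> t x = 0"
    and init: "\<And>\<epsilon>. \<epsilon> > 0 \<Longrightarrow> AE x in lebesgue_on (\<Omega>p \<epsilon>). u \<epsilon> 0 x = u0 x"
    using sol by (auto simp: perforated_solution_def)
  have pos: "\<forall>\<^sub>F \<epsilon> in at_right (0::real). \<epsilon> > 0" by (rule eventually_at_right_less)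

  have "\<forall>\<^sub>F \<epsilon> in at_right 0. (indicator (\<Omega>p \<epsilon>) :: 'a \<Rightarrow> real) \<in> borel_measurable (lebesgue_on \<Omega>) \<and>
      (AE y in lebesgue_on \<Omega>. \<bar>indicator (\<Omega>p \<epsilon>) y :: real\<bar> \<le> max M0 1)"
    using pos
  proof eventually_elim
    case (elim \<epsilon>)
    then show ?case
      using P[of \<epsilon>] by (auto simp: sets_restrict_space_iff indicator_def intro!: borel_measurable_indicator)
  qed
  \<comment> \<open>The denominators converge uniformly, hence exceed \<open>m / 2\<close> on \<open>\<Omega>\<close> for small \<open>\<epsilon>\<close>. The time interval \<open>{0}\<close>
      and the profile 1 are dummies.\<close>
  from uniform_limit_kernel_integral[OF k2 compact_sing[of 0] _ continuous_on_const[of _ "(0, const_bcontfun 1)"] this weak, of "closure \<Omega>"]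
  have "uniform_limit ({0} \<times> closure \<Omega>) (\<lambda>\<epsilon> (t :: real, x). kernel_integral \<Omega> k2 (indicator (\<Omega>p \<epsilon>)) x)
     (\<lambda>(t, x). kernel_integral \<Omega> k2 \<X> x) (at_right 0)"
    using bdd_\<Omega> by (simp add: profile_def const_bcontfun.rep_eq)
  from uniform_limitD[OF this, of "m / 2"] m(1)
  have "\<forall>\<^sub>F \<epsilon> in at_right 0. \<forall>x\<in>closure \<Omega>. dist (kernel_integral \<Omega> k2 (indicator (\<Omega>p \<epsilon>)) x) (kernel_integral \<Omega> k2 \<X> x) < m / 2"
    by simp
  with pos have eq: "\<forall>\<^sub>F \<epsilon> in at_right 0. \<forall>t. AE x in lebesgue_on (\<Omega>p \<epsilon>).
       u' \<epsilon> t x = reaction (indicator (\<Omega>p \<epsilon>)) (u \<epsilon> t) x - u \<epsilon> t x"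
  proof eventually_elim
    case (elim \<epsilon>)
    note close = elim(2)
    show ?case
    proof
      fix t
      have "AE x in lebesgue_on (\<Omega>p \<epsilon>). x \<in> \<Omega>p \<epsilon>" using P(1)[OF elim(1)] by (intro AE_I2) simp
      with u'[OF elim(1), of t] show "AE x in lebesgue_on (\<Omega>p \<epsilon>). u' \<epsilon> t x = reaction (indicator (\<Omega>p \<epsilon>)) (u \<epsilon> t) x - u \<epsilon> t x"
      proof eventually_elim
        case (elim x)
        note \<epsilon> = \<open>\<epsilon> > 0\<close>
        have x: "x \<in> \<Omega>" using elim P(2)[OF \<epsilon>] by auto
        \<comment> \<open>All integrals reduce to \<open>\<Omega>\<close> because \<open>u \<epsilon> t\<close> vanishes off \<open>\<Omega>p \<epsilon>\<close>.\<close>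
        have "(LINT y:(UNIV - (\<Omega> - \<Omega>p \<epsilon>))|lebesgue. J (x - y) * u \<epsilon> t y) = kernel_integral \<Omega> k1 (u \<epsilon> t) x"
          unfolding kernel_integral_def
          using zero[OF \<epsilon>] P(2)[OF \<epsilon>] KJ[OF x] by (intro set_int) (auto simp: indicator_def k1_def)
        moreover have "(LINT y:(ball x \<delta> \<inter> \<Omega>p \<epsilon>)|lebesgue. u \<epsilon> t y) = kernel_integral \<Omega> k2 (u \<epsilon> t) x"
          unfolding kernel_integral_def
          using zero[OF \<epsilon>] P(2)[OF \<epsilon>] by (intro set_int) (auto simp: indicator_def k2_def)
        moreover have "measure lebesgue (ball x \<delta> \<inter> \<Omega>p \<epsilon>) = kernel_integral \<Omega> k2 (indicator (\<Omega>p \<epsilon>)) x"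
        proof -
          have "measure lebesgue (ball x \<delta> \<inter> \<Omega>p \<epsilon>) = (LINT y:(ball x \<delta> \<inter> \<Omega>p \<epsilon>)|lebesgue. 1)"
            by (simp add: set_lebesgue_integral_def)
          also have "\<dots> = kernel_integral \<Omega> k2 (indicator (\<Omega>p \<epsilon>)) x"
            unfolding kernel_integral_def
            using P(2)[OF \<epsilon>] by (intro set_int) (auto simp: indicator_def k2_def)
          finally show ?thesis .
        qed
        moreover have "kernel_integral \<Omega> k2 (indicator (\<Omega>p \<epsilon>)) x \<ge> m / 2"
        proof -
          have "x \<in> closure \<Omega>" using x closure_subset by blast
          then have "m \<le> kernel_integral \<Omega> k2 \<X> x"
            and "dist (kernel_integral \<Omega> k2 (indicator (\<Omega>p \<epsilon>)) x) (kernel_integral \<Omega> k2 \<X> x) < m / 2"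
            using m(2) close by auto
          then show ?thesis unfolding dist_real_def by linarith
        qed
        ultimately show ?case
          using elim(1) by (simp add: reaction_def mean_on_def max_def)
      qed
    qed
  qed

  have "limit_solution J g \<delta> \<X> \<Omega> u0 ustar"
    unfolding limit_solution_def
  proof (intro conjI exI[of _ "\<lambda>t x. \<X> x * profile u0 (vector_field (\<zeta> t)) x"] allI impI)
    show "ustar t x = 0" if "x \<notin> \<Omega>" for t x using X_zero[OF that] by (simp add: ustar_def)
    show "AE x in lebesgue_on \<Omega>. ustar 0 x = \<X> x * u0 x" by (simp add: ustar_def \<zeta>0 profile_def)
    show "L2_C1_deriv_on {a..b} UNIV ustar (\<lambda>t x. \<X> x * profile u0 (vector_field (\<zeta> t)) x)" for a b
      unfolding ustar_def[abs_def] by (rule limit_C1[OF \<zeta>])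
    fix t
    have ustar_int: "integrable (lebesgue_on \<Omega>) (ustar t)"
      unfolding ustar_def[abs_def] by (rule X_profile_integrable)
    show "AE x in lebesgue_on \<Omega>. \<X> x * profile u0 (vector_field (\<zeta> t)) x =
        \<X> x * (LINT y|lebesgue. J (x - y) * (ustar t y - ustar t x)) +
        \<X> x * g (mean_weight \<delta> \<X> x (ustar t)) + (\<X> x - 1) * ustar t x"
    proof (rule AE_I2)
      fix x assume "x \<in> space (lebesgue_on \<Omega>)"
      then have x: "x \<in> \<Omega>" by simp
      have J: "has_bochner_integral lebesgue (\<lambda>y. J (x - y)) 1"
        by (rule has_bochner_integral_lebesgue_reflect_translate[OF J_cont J_int])
      have Ju: "J (x - y) * ustar t y = indicator \<Omega> y *\<^sub>R (k1 x y * ustar t y)" for y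
        using KJ[OF x] X_zero by (cases "y \<in> \<Omega>") (auto simp: k1_def ustar_def)
      have "integrable lebesgue (\<lambda>y. J (x - y) * ustar t y)"
        unfolding Ju using averaging_kernel_integrable[OF k1 ustar_int] \<Omega>_meas by (simp add: integrable_restrict_space)
      then have "(LINT y|lebesgue. J (x - y) * (ustar t y - ustar t x)) =
          (LINT y|lebesgue. J (x - y) * ustar t y) - ustar t x"
        using J by (simp add: right_diff_distrib has_bochner_integral_iff)
      also have "(LINT y|lebesgue. J (x - y) * ustar t y) = kernel_integral \<Omega> k1 (ustar t) x"
        unfolding Ju kernel_integral_def using \<Omega>_meas by (simp add: integral_restrict_space)
      finally have conv: "(LINT y|lebesgue. J (x - y) * (ustar t y - ustar t x)) = kernel_integral \<Omega> k1 (ustar t) x - ustar t x" .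
      have ball_int: "(LINT y:ball x \<delta>|lebesgue. f y) = kernel_integral \<Omega> k2 f x" if "\<And>y. y \<notin> \<Omega> \<Longrightarrow> f y = 0" for f
        unfolding kernel_integral_def using that by (intro set_int) (auto simp: indicator_def k2_def)
      have "mean_weight \<delta> \<X> x (ustar t) = kernel_integral \<Omega> k2 (ustar t) x / kernel_integral \<Omega> k2 \<X> x"
        unfolding mean_weight_def using X_zero by (subst (1 2) ball_int) (auto simp: ustar_def)
      moreover have "kernel_integral \<Omega> k2 \<X> x \<ge> m / 2"
        using m(2)[of x] m(1) x closure_subset by force
      ultimately have "reaction \<X> (ustar t) x = kernel_integral \<Omega> k1 (ustar t) x + g (mean_weight \<delta> \<X> x (ustar t))"
        by (simp add: reaction_def max_def)
      moreover have "\<X> x * profile u0 (vector_field (\<zeta> t)) x = \<X> x * reaction \<X> (ustar t) x - ustar t x"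
        by (simp add: profile_vector_field ustar_def[abs_def] right_diff_distrib)
      ultimately show "\<X> x * profile u0 (vector_field (\<zeta> t)) x =
          \<X> x * (LINT y|lebesgue. J (x - y) * (ustar t y - ustar t x)) +
          \<X> x * g (mean_weight \<delta> \<X> x (ustar t)) + (\<X> x - 1) * ustar t x"
        unfolding conv by (simp add: algebra_simps)
    qed
  qed
  moreover have "weakstar_Linf_L2 a b \<Omega> u ustar (at_right 0)" if "a < b" for a b
    unfolding ustar_def[abs_def]
    by (rule perforated_solution_weakstar[OF \<zeta>0 \<zeta> P weak zero init C1 eq that])
  ultimately show ?thesis by blast
qed

end
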